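(* Let $G=(V,E)$ be a finite connected simple undirected graph (no multi-edges, no loops), let $d_v$ denote the degree of $v$ in $G$, let $\tau(G)$ be the number of spanning trees of $G$, and let $x,y\in V$. Then $$H(x,y)=\frac{1}{\tau(G)}\sum_{u\in V}d_u\sum_{\substack{P\in\mathscr P_G(x,u)\\ y\notin P}}R\big(G-\{P,y\},d_G\big).$$ Moreover, for every such path $P$ (with $y\notin P$), $R(G-\{P,y\},d_G)=\tau(G/\{P,y\})$.
   Context: $H(x,y)$ is the hitting time of the simple random walk on $G$ (which at each step moves from the current vertex $v$ to a uniformly random neighbor, each with probability $1/d_v$): the expected number of steps to reach $y$ when started at $x$. $\mathscr P_G(x,u)$ is the set of simple paths (no repeated vertices) in $G$ from $x$ to $u$; by convention $\mathscr P_G(x,x)$ consists only of the trivial path $\{x\}$. "$y\notin P$" means $y$ is not a vertex of $P$. $G-\{P,y\}$ is the induced subgraph of $G$ obtained by deleting all vertices of $P$ and the vertex $y$, and $d_G$ denotes the weight function $v\mapsto d_v$ (degrees in $G$) restricted to that subgraph. $G/\{P,y\}$ is the multigraph obtained from $G$ by identifying all vertices of $P$ together with $y$ into a single vertex (keeping multiple edges, deleting loops); its spanning trees are counted with edge multiplicities. For a vertex-weighted graph $(G',w)$ (a finite simple graph $G'$ with $w:V(G')\to\mathbb R$), the invariant $R(G',w)$ is defined by $R(\emptyset,w)=1$ and, for any vertex $x$ of $G'$, $$R(G',w)=w_xR(G'-\{x\},w)-\sum_{\substack{z\in V(G')\\ z\sim x}}\sum_{Q\in\mathscr P_{G'}(x,z)}R(G'-\{Q\},w),$$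 where $z\sim x$ means adjacency, $G'-\{Q\}$ deletes the vertices of $Q$, and $w$ is restricted to subgraphs; these relations determine $R$ uniquely (independently of the choice of $x$). Equivalently, when $w$ is integer-valued with $w_v\ge \deg_{G'}(v)$, $R(G',w)$ equals the number of spanning trees of the multigraph obtained from $G'$ by adding a new vertex $\bullet$ and $w_v-\deg_{G'}(v)$ edges between $\bullet$ and $v$ for each $v$. *)

theory Defs
  imports "HOL-Probability.Probability"
begin

text \<open>
  Finite undirected graphs are multigraphs with abstract edges, each edge having a set of one or two
  end vertices. A simple graph is a multigraph without loops in which an edge is determined by its
  two ends, so that spanning trees are defined once for simple graphs and for their contractions.
\<close>

record ('v, 'e) multigraph =
  verts :: "'v set"
  edges :: "'e set"
  ends :: "'e \<Rightarrow> 'v set"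

definition simple_graph :: "('v, 'e) multigraph \<Rightarrow> bool" where
  "simple_graph G \<longleftrightarrow>
     finite (verts G) \<and>
     (\<forall>e\<in>edges G. ends G e \<subseteq> verts G \<and> card (ends G e) = 2) \<and>
     inj_on (ends G) (edges G)"

definition adjacent :: "('v, 'e) multigraph \<Rightarrow> 'v \<Rightarrow> 'v \<Rightarrow> bool" where
  "adjacent G u v \<longleftrightarrow> (\<exists>e\<in>edges G. ends G e = {u, v})"

definition neighbors :: "('v, 'e) multigraph \<Rightarrow> 'v \<Rightarrow> 'v set" where
  "neighbors G v = {u. adjacent G v u}"

text \<open>The following notion of degree is only meant for simple graphs.\<close>

definition vertex_degree :: "('v, 'e) multigraph \<Rightarrow> 'v \<Rightarrow> nat" where
  "vertex_degree G v = card (neighbors G v)"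

definition connected_graph :: "('v, 'e) multigraph \<Rightarrow> bool" where
  "connected_graph G \<longleftrightarrow> (\<forall>u\<in>verts G. \<forall>v\<in>verts G. (adjacent G)\<^sup>*\<^sup>* u v)"

text \<open>
  Loops are cycles of length 1 and pairs of parallel edges are cycles of length 2.
\<close>

definition is_cycle :: "('v, 'e) multigraph \<Rightarrow> 'v list \<Rightarrow> 'e list \<Rightarrow> bool" where
  "is_cycle G vs es \<longleftrightarrow>
     vs \<noteq> [] \<and> length es = length vs \<and> distinct vs \<and> distinct es \<and>
     (\<forall>i<length vs. es ! i \<in> edges G \<and>
        ends G (es ! i) = {vs ! i, vs ! (Suc i mod length vs)})"

definition is_tree :: "('v, 'e) multigraph \<Rightarrow> bool" where
  "is_tree G \<longleftrightarrow> connected_graph G \<and> (\<nexists>vs es. is_cycle G vs es)"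

definition spanning_trees :: "('v, 'e) multigraph \<Rightarrow> 'e set set" where
  "spanning_trees G = {T. T \<subseteq> edges G \<and> is_tree (G\<lparr>edges := T\<rparr>)}"

definition num_spanning_trees :: "('v, 'e) multigraph \<Rightarrow> nat" where
  "num_spanning_trees G = card (spanning_trees G)"

definition delete_verts :: "('v, 'e) multigraph \<Rightarrow> 'v set \<Rightarrow> ('v, 'e) multigraph" where
  "delete_verts G S =
     \<lparr>verts = verts G - S, edges = {e \<in> edges G. ends G e \<inter> S = {}}, ends = ends G\<rparr>"

text \<open>
  The vertices of the contraction are the classes of the partition of the vertex set into
  \<^term>\<open>S\<close> and singletons. Edges keep their identity, so that edges with the same image
  remain distinct parallel edges; those inside \<^term>\<open>S\<close> would become loops and are removed.
\<close>

definition contract :: "('v, 'e) multigraph \<Rightarrow> 'v set \<Rightarrow> ('v set, 'e) multigraph" where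
  "contract G S =
     (let cls = (\<lambda>v. if v \<in> S then S else {v}) in
       \<lparr>verts = cls ` verts G,
        edges = {e \<in> edges G. \<not> ends G e \<subseteq> S},
        ends = (\<lambda>e. cls ` ends G e)\<rparr>)"

text \<open>A path in a simple graph is given by its list of vertices.\<close>

definition simple_paths :: "('v, 'e) multigraph \<Rightarrow> 'v \<Rightarrow> 'v \<Rightarrow> 'v list set" where
  "simple_paths G x u =
     {P. P \<noteq> [] \<and> hd P = x \<and> last P = u \<and> distinct P \<and> set P \<subseteq> verts G \<and>
         successively (adjacent G) P}"

text \<open>
  The invariant \<open>R\<close> of vertex-weighted simple graphs is the solution of the following relations,
  which are required for every choice of the vertex \<open>x\<close>. On simple graphs the solution is
  unique; its values on other multigraphs are irrelevant.
\<close>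

definition R_relations :: "(('v, 'e) multigraph \<Rightarrow> ('v \<Rightarrow> real) \<Rightarrow> real) \<Rightarrow> bool" where
  "R_relations f \<longleftrightarrow>
     (\<forall>G w. simple_graph G \<longrightarrow>
        (verts G = {} \<longrightarrow> f G w = 1) \<and>
        (\<forall>x\<in>verts G. f G w =
           w x * f (delete_verts G {x}) w
           - (\<Sum>z\<in>neighbors G x. \<Sum>Q\<in>simple_paths G x z. f (delete_verts G (set Q)) w)))"

definition R_invariant :: "('v, 'e) multigraph \<Rightarrow> ('v \<Rightarrow> real) \<Rightarrow> real" where
  "R_invariant = (SOME f. R_relations f)"

text \<open>
  The simple random walk started at \<open>x\<close> is the probability measure on trajectories
  obtained by the Ionescu-Tulcea construction from the transition kernel
  that moves from the current vertex to a uniformly random neighbor.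
\<close>

definition walk_kernel :: "('v, 'e) multigraph \<Rightarrow> 'v \<Rightarrow> nat \<Rightarrow> (nat \<Rightarrow> 'v) \<Rightarrow> 'v measure" where
  "walk_kernel G x n \<omega> =
     (case n of
        0 \<Rightarrow> measure_pmf (return_pmf x)
      | Suc m \<Rightarrow> measure_pmf (pmf_of_set (neighbors G (\<omega> m))))"

lemma Ionescu_Tulcea_walk_kernel:
  fixes G :: "('v, 'e) multigraph" and x :: 'v
  shows "Ionescu_Tulcea (walk_kernel G x) (\<lambda>_. count_space UNIV)"
proof (rule Ionescu_Tulcea.intro)
  fix i
  show "walk_kernel G x i \<in> measurable (PiM {0..<i} (\<lambda>_. count_space UNIV))
          (subprob_algebra (count_space UNIV))"
  proof (cases i)
    case 0
    then have "walk_kernel G x i = (\<lambda>_. measure_pmf (return_pmf x))"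
      by (simp add: walk_kernel_def fun_eq_iff)
    then show ?thesis
      by (simp add: space_subprob_algebra measure_pmf.subprob_space_axioms)
  next
    case (Suc m)
    have "(\<lambda>\<omega>. \<omega> m) \<in> measurable (PiM {0..<i} (\<lambda>_. count_space (UNIV :: 'v set))) (count_space UNIV)"
      using Suc by (intro measurable_component_singleton) simp
    moreover have "(\<lambda>v. measure_pmf (pmf_of_set (neighbors G v)))
        \<in> measurable (count_space UNIV) (subprob_algebra (count_space UNIV))"
      by (simp add: space_subprob_algebra measure_pmf.subprob_space_axioms)
    ultimately have "(\<lambda>\<omega>. measure_pmf (pmf_of_set (neighbors G (\<omega> m))))
        \<in> measurable (PiM {0..<i} (\<lambda>_. count_space UNIV)) (subprob_algebra (count_space UNIV))"
      by (rule measurable_compose)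
    then show ?thesis
      by (simp add: Suc walk_kernel_def[abs_def])
  qed
next
  fix i :: nat and \<omega> :: "nat \<Rightarrow> 'v"
  show "prob_space (walk_kernel G x i \<omega>)"
    by (cases i) (simp_all add: walk_kernel_def measure_pmf.prob_space_axioms)
qed

definition random_walk :: "('v, 'e) multigraph \<Rightarrow> 'v \<Rightarrow> (nat \<Rightarrow> 'v) measure" where
  "random_walk G x =
     projective_family.lim UNIV
       (Ionescu_Tulcea.CI (walk_kernel G x) (\<lambda>_. count_space UNIV)) (\<lambda>_. count_space UNIV)"

text \<open>The number of steps is infinite if the trajectory never visits \<open>y\<close>.\<close>

definition steps_to :: "'v \<Rightarrow> (nat \<Rightarrow> 'v) \<Rightarrow> enat" where
  "steps_to y \<omega> = (INF n\<in>{n. \<omega> n = y}. enat n)"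

definition hitting_time :: "('v, 'e) multigraph \<Rightarrow> 'v \<Rightarrow> 'v \<Rightarrow> ennreal" where
  "hitting_time G x y = (\<integral>\<^sup>+\<omega>. ennreal_of_enat (steps_to y \<omega>) \<partial>random_walk G x)"

end

theory Submission
  imports Defs
begin

text \<open>
  Call a map that sends each vertex of a set \<open>U\<close> to a neighbour, or to an exit, acyclic if no nonempty
  subset of \<open>U\<close> is closed under it. Fixing the values outside a vertex \<open>x\<close> to be acyclic, a map either
  is acyclic or has exactly one cycle, which passes through \<open>x\<close>; so weighted counts of acyclic maps
  satisfy the relations of \<open>R\<close>, which gives existence, and uniqueness is induction. With degrees as
  weights, \<open>R\<close> counts the acyclic maps from \<open>V - S\<close> into \<open>V\<close>, i.e. the spanning forests oriented
  towards \<open>S\<close>, i.e. the spanning trees of the contraction of \<open>S\<close>.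

  The path sums \<open>g(v,u) = \<Sum>\<^sub>P R(G - {P,y})\<close> satisfy \<open>d\<^sub>v g(v,u) = \<tau>(G) [v = u] + \<Sum>\<^sub>z\<^sub>~\<^sub>v g(z,u)\<close>: expand
  \<open>R\<close> at \<open>v\<close> and glue the resulting closed path through \<open>v\<close> to the given path out of \<open>v\<close>.
  Hence \<open>k(v) = \<tau>(G)\<^sup>-\<^sup>1 \<Sum>\<^sub>u d\<^sub>u g(v,u)\<close> is one plus its average over the neighbours of \<open>v\<close>, and telescoping
  the expectation of \<open>k\<close> along the walk killed at \<open>y\<close> identifies \<open>k(x)\<close> with the hitting time.
\<close>

section \<open>Acyclic maps\<close>

text \<open>Equivalently, iterating \<open>f\<close> from any vertex of \<open>U\<close> eventually
  leaves \<open>U\<close>; the value \<open>None\<close> and values outside \<open>U\<close> both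
  count as leaving. Phrased by closed subsets, acyclicity passes to smaller \<open>U\<close> at once
  and is refuted by any closed set at hand.\<close>

definition acyclic_map :: "'v set \<Rightarrow> ('v \<Rightarrow> 'v option) \<Rightarrow> bool" where
  "acyclic_map U f \<longleftrightarrow> (\<forall>S\<subseteq>U. S \<noteq> {} \<longrightarrow> (\<exists>v\<in>S. f v \<notin> Some ` S))"

text \<open>A cycle of \<open>f\<close>, with the index wrapping around at the end of the list; a
  list of length one is a fixed point.\<close>

definition orbit :: "('v \<Rightarrow> 'v option) \<Rightarrow> 'v list \<Rightarrow> bool" where
  "orbit f Q \<longleftrightarrow> (\<forall>i<length Q. f (Q ! i) = Some (Q ! (Suc i mod length Q)))"

text \<open>Directed cycles through \<open>x\<close> in the digraph with an arc from
  \<open>v\<close> to \<open>z\<close> whenever \<open>Some z \<in> N v\<close>. Listing them from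
  \<open>x\<close> on represents each cycle once. In an undirected graph an edge gives a cycle of
  length two and a longer cycle gives two, one per direction.\<close>

definition rooted_cycles :: "('v \<Rightarrow> 'v option set) \<Rightarrow> 'v set \<Rightarrow> 'v \<Rightarrow> 'v list set" where
  "rooted_cycles N U x = {Q. Q \<noteq> [] \<and> hd Q = x \<and> distinct Q \<and> set Q \<subseteq> U \<and>
     (\<forall>i<length Q. Some (Q ! (Suc i mod length Q)) \<in> N (Q ! i))}"

text \<open>For finite data this is the forest expansion of a determinant, as in the matrix-tree
  theorem: the diagonal matrix of row sums of \<open>g\<close> minus the matrix of arcs inside
  \<open>U\<close>.\<close>

definition acyclic_sum :: "('v \<Rightarrow> 'v option set) \<Rightarrow> ('v \<Rightarrow> 'v option \<Rightarrow> real) \<Rightarrow> 'v set \<Rightarrow> real" where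
  "acyclic_sum N g U = (\<Sum>f\<in>{f \<in> PiE U N. acyclic_map U f}. \<Prod>v\<in>U. g v (f v))"

lemma acyclic_map_subset: "acyclic_map U f \<Longrightarrow> U' \<subseteq> U \<Longrightarrow> acyclic_map U' f"
  unfolding acyclic_map_def by blast

lemma acyclic_map_cong:
  assumes "\<And>v. v \<in> U \<Longrightarrow> f v = g v"
  shows "acyclic_map U f \<longleftrightarrow> acyclic_map U g"
proof -
  have "(\<exists>v\<in>S. f v \<notin> Some ` S) \<longleftrightarrow> (\<exists>v\<in>S. g v \<notin> Some ` S)" if "S \<subseteq> U" for S
    using assms that by (metis subsetD)
  then show ?thesis unfolding acyclic_map_def by blast
qed

lemma orbit_not_acyclic_map:
  assumes "orbit f Q" "Q \<noteq> []" "set Q \<subseteq> U"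
  shows "\<not> acyclic_map U f"
proof
  assume "acyclic_map U f"
  then obtain v where "v \<in> set Q" "f v \<notin> Some ` set Q"
    using assms unfolding acyclic_map_def by (metis set_empty)
  then obtain i where i: "i < length Q" "v = Q ! i" by (metis in_set_conv_nth)
  then have "Suc i mod length Q < length Q" by (intro mod_less_divisor) auto
  then show False
    using \<open>f v \<notin> Some ` set Q\<close> assms(1) i by (auto simp: orbit_def)
qed

text \<open>Removing \<open>x\<close> already breaks the cycle: if a set avoiding \<open>x\<close>
  meets \<open>Q\<close>, take the last position of \<open>Q\<close> in it. The next vertex of the
  cycle is either a later position or, after wrapping around, \<open>x\<close>; both lie outside the
  set.\<close>

lemma acyclic_map_diff_root:
  assumes orb: "orbit f Q" and "hd Q = x" and ac: "acyclic_map (U - set Q) f"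
  shows "acyclic_map (U - {x}) f"
  unfolding acyclic_map_def
proof (intro allI impI)
  fix T assume T: "T \<subseteq> U - {x}" "T \<noteq> {}"
  show "\<exists>v\<in>T. f v \<notin> Some ` T"
  proof (cases "T \<inter> set Q = {}")
    case True
    then have "T \<subseteq> U - set Q" using T by blast
    then show ?thesis using ac T unfolding acyclic_map_def by simp
  next
    case False
    define I where "I = {i. i < length Q \<and> Q ! i \<in> T}"
    have "finite I" "I \<noteq> {}"
      using False by (auto simp: I_def in_set_conv_nth)
    define i where "i = Max I"
    have i: "i < length Q" "Q ! i \<in> T"
      using Max_in[OF \<open>finite I\<close> \<open>I \<noteq> {}\<close>] by (auto simp: i_def I_def)
    have max: "j \<le> i" if "j < length Q" "Q ! j \<in> T" for j
      using that \<open>finite I\<close> unfolding i_def by (intro Max_ge) (auto simp: I_def)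
    have "Q ! (Suc i mod length Q) \<notin> T"
    proof (cases "Suc i < length Q")
      case True
      then show ?thesis using max[of "Suc i"] by auto
    next
      case False
      then have "Suc i = length Q" using i by simp
      then have "Suc i mod length Q = 0" by simp
      moreover have "Q ! 0 = x" using i \<open>hd Q = x\<close> by (cases Q) auto
      ultimately show ?thesis using T by auto
    qed
    then have "f (Q ! i) \<notin> Some ` T"
      using orb i by (auto simp: orbit_def)
    then show ?thesis using i by blast
  qed
qed

text \<open>Any closed set contains \<open>x\<close>, since off \<open>x\<close> the map is acyclic.
  So the trajectory of \<open>x\<close> runs inside a closed set forever, and its first return to
  \<open>x\<close> cuts out the cycle.\<close>

lemma obtain_orbit:
  assumes "finite U" and nac: "\<not> acyclic_map U f" and ac: "acyclic_map (U - {x}) f"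
  obtains Q where "Q \<noteq> []" "hd Q = x" "distinct Q" "set Q \<subseteq> U" "orbit f Q"
proof -
  obtain S where S: "S \<subseteq> U" "S \<noteq> {}" "\<And>v. v \<in> S \<Longrightarrow> f v \<in> Some ` S"
    using nac by (auto simp: acyclic_map_def)
  have inS: "x \<in> S'" if "S' \<subseteq> U" "S' \<noteq> {}" "\<And>v. v \<in> S' \<Longrightarrow> f v \<in> Some ` S'" for S'
  proof (rule ccontr)
    assume "x \<notin> S'"
    then have "S' \<subseteq> U - {x}" using that(1) by blast
    then show False using ac that unfolding acyclic_map_def by blast
  qed
  define g where "g v = the (f v)" for v
  define s where "s i = (g ^^ i) x" for i
  have s_add: "s (i + k) = (g ^^ k) (s i)" for i k
    by (simp add: s_def add.commute[of i] funpow_add)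
  have g: "g v \<in> S \<and> f v = Some (g v)" if "v \<in> S" for v
    using S(3)[OF that] by (auto simp: g_def)
  have sS: "s i \<in> S" for i
    by (induction i) (use inS[OF S] g in \<open>auto simp: s_def\<close>)
  have fs: "f (s i) = Some (s (Suc i))" for i
    using g[OF sS[of i]] by (simp add: s_def)
  \<comment> \<open>The positions from time one on form a closed set, hence contain
    \<open>x\<close>: the trajectory returns.\<close>
  have "x \<in> range (\<lambda>i. s (Suc i))"
    using sS S(1) by (intro inS) (auto simp: fs)
  then have ex: "\<exists>n. 0 < n \<and> s n = x" by (metis imageE zero_less_Suc)
  define n where "n = (LEAST n. 0 < n \<and> s n = x)"
  have n: "0 < n" "s n = x"
    using LeastI_ex[OF ex] by (auto simp: n_def)
  have least: "n \<le> m" if "0 < m" "s m = x" for m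
    unfolding n_def using that by (intro Least_le) auto
  \<comment> \<open>Shifting a repetition at times \<open>i < j\<close> by \<open>n - j\<close>
    would give a return to \<open>x\<close> at time \<open>i + (n - j)\<close>, which is positive
    and below \<open>n\<close>.\<close>
  have neq: "s i \<noteq> s j" if "i < j" "j < n" for i j
  proof
    assume "s i = s j"
    then have "s (i + (n - j)) = s (j + (n - j))"
      unfolding s_add by simp
    then have "s (i + (n - j)) = x"
      using that n by simp
    then show False using least[of "i + (n - j)"] that by simp
  qed
  have "inj_on s {..<n}"
    by (rule linorder_inj_onI') (use neq in auto)
  then have "distinct (map s [0..<n])"
    by (simp add: distinct_map lessThan_atLeast0)
  moreover have "orbit f (map s [0..<n])"
    unfolding orbit_def
  proof (intro allI impI)
    fix i assume "i < length (map s [0..<n])"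
    then have i: "i < n" by simp
    have "s (Suc i) = s (Suc i mod n)"
    proof (cases "Suc i < n")
      case False
      then have "Suc i = n" using i by simp
      then show ?thesis using n by (simp add: s_def)
    qed simp
    then show "f (map s [0..<n] ! i) = Some (map s [0..<n] ! (Suc i mod length (map s [0..<n])))"
      using i n by (simp add: fs)
  qed
  moreover have "hd (map s [0..<n]) = x"
    using n by (simp add: hd_map s_def)
  moreover have "set (map s [0..<n]) \<subseteq> U" using sS S(1) by auto
  ultimately show ?thesis using n that[of "map s [0..<n]"] by simp
qed

text \<open>Both lists are read off the same trajectory of \<open>f\<close> from the common head. If
  one were longer, the trajectory would return to the head inside it, against distinctness.\<close>

lemma orbit_unique:
  assumes "orbit f Q" "orbit f Q'" "distinct Q" "distinct Q'" "Q \<noteq> []" "Q' \<noteq> []" "hd Q = hd Q'"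
  shows "Q = Q'"
proof -
  define s where "s i = ((\<lambda>v. the (f v)) ^^ i) (hd Q)" for i
  have nth: "P ! (i mod length P) = s i" if "orbit f P" "P \<noteq> []" "hd P = hd Q" for P i
  proof (induction i)
    case 0
    then show ?case using that by (simp add: s_def hd_conv_nth)
  next
    case (Suc i)
    have "i mod length P < length P" using that by simp
    then have "f (s i) = Some (P ! (Suc i mod length P))"
      using that(1) Suc unfolding orbit_def by (metis mod_Suc_eq)
    then show ?case by (simp add: s_def)
  qed
  have le: "length P' \<le> length P" if "orbit f P" "orbit f P'" "distinct P'" "P \<noteq> []" "P' \<noteq> []" "hd P = hd Q" "hd P' = hd Q"
    for P P'
  proof (rule ccontr)
    assume "\<not> length P' \<le> length P"
    then have less: "length P < length P'" by simp
    have "P' ! length P = s (length P)" using nth[of P' "length P"] that less by simp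
    also have "\<dots> = P ! 0" using nth[of P "length P"] that by simp
    also have "\<dots> = P' ! 0" using that by (simp flip: hd_conv_nth)
    finally show False
      using less that by (simp add: nth_eq_iff_index_eq)
  qed
  have len: "length Q = length Q'"
    using le[OF assms(2,1,3,6,5) assms(7)[symmetric] refl] le[OF assms(1,2,4,5,6) refl assms(7)[symmetric]]
    by (rule antisym)
  show ?thesis
  proof (rule nth_equalityI[OF len])
    fix i assume "i < length Q"
    then show "Q ! i = Q' ! i"
      using nth[OF assms(1,5) refl, of i] nth[OF assms(2,6) assms(7)[symmetric], of i] len by simp
  qed
qed

text \<open>Values on the cycle are forced by \<open>Q\<close> and have weight one, so they can be
  forgotten; what remains is an arbitrary acyclic map off the cycle, by
  \<open>acyclic_map_diff_root\<close>.\<close>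

lemma acyclic_sum_orbit:
  assumes "finite U" and Q: "Q \<in> rooted_cycles N U x" and g: "\<And>v z. g v (Some z) = 1"
  shows "(\<Sum>f\<in>{f \<in> PiE U N. acyclic_map (U - {x}) f \<and> orbit f Q}. \<Prod>v\<in>U. g v (f v)) =
    acyclic_sum N g (U - set Q)"
proof -
  define nxt where "nxt = map_of (zip Q (rotate1 Q))"
  have Q': "Q \<noteq> []" "hd Q = x" "distinct Q" "set Q \<subseteq> U"
    "\<And>i. i < length Q \<Longrightarrow> Some (Q ! (Suc i mod length Q)) \<in> N (Q ! i)"
    using Q by (auto simp: rooted_cycles_def)
  have nxt: "nxt (Q ! i) = Some (Q ! (Suc i mod length Q))" if "i < length Q" for i
    unfolding nxt_def using that Q'(3) by (subst map_of_zip_nth) (auto simp: nth_rotate1)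
  have orb: "orbit f Q \<longleftrightarrow> (\<forall>v\<in>set Q. f v = nxt v)" for f
    by (auto simp: orbit_def all_set_conv_all_nth nxt)
  have nxtN: "nxt v \<in> N v" if "v \<in> set Q" for v
    using that Q'(5) by (auto simp: in_set_conv_nth nxt)
  have nxtS: "\<exists>z. nxt v = Some z" if "v \<in> set Q" for v
    using that by (auto simp: in_set_conv_nth nxt)
  have weight: "(\<Prod>v\<in>U. g v (f v)) = (\<Prod>v\<in>U - set Q. g v (f v))" if "orbit f Q" for f
  proof -
    have "g v (f v) = 1" if "v \<in> set Q" for v
      using that \<open>orbit f Q\<close> nxtS g unfolding orb by metis
    then show ?thesis
      using \<open>finite U\<close> by (intro prod.mono_neutral_right) auto
  qed
  let ?ext = "\<lambda>f v. if v \<in> set Q then nxt v else f v"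
  show ?thesis
    unfolding acyclic_sum_def
  proof (rule sum.reindex_bij_witness[where i = ?ext and j = "\<lambda>f. restrict f (U - set Q)"])
    fix f assume f: "f \<in> {f \<in> PiE U N. acyclic_map (U - {x}) f \<and> orbit f Q}"
    show "?ext (restrict f (U - set Q)) = f"
      using f Q'(4) by (auto simp: fun_eq_iff orb PiE_iff extensional_def)
    have "acyclic_map (U - set Q) f"
      using f Q' by (auto intro: acyclic_map_subset)
    then have "acyclic_map (U - set Q) (restrict f (U - set Q))"
      by (subst acyclic_map_cong[where g = f]) auto
    then show "restrict f (U - set Q) \<in> {f \<in> PiE (U - set Q) N. acyclic_map (U - set Q) f}"
      using f by (auto simp: PiE_iff)
    show "(\<Prod>v\<in>U - set Q. g v (restrict f (U - set Q) v)) = (\<Prod>v\<in>U. g v (f v))"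
      using f by (simp add: weight)
  next
    fix f assume f: "f \<in> {f \<in> PiE (U - set Q) N. acyclic_map (U - set Q) f}"
    show "restrict (?ext f) (U - set Q) = f"
      using f by (auto simp: fun_eq_iff PiE_iff extensional_def)
    have o: "orbit (?ext f) Q" by (simp add: orb)
    have "acyclic_map (U - set Q) (?ext f)"
      using f by (subst acyclic_map_cong[where g = f]) auto
    then have "acyclic_map (U - {x}) (?ext f)"
      using o Q' by (intro acyclic_map_diff_root[where Q=Q])
    then show "?ext f \<in> {f \<in> PiE U N. acyclic_map (U - {x}) f \<and> orbit f Q}"
      using f o Q'(4) nxtN by (auto simp: PiE_iff extensional_def)
  qed
qed

text \<open>The left side counts maps that are acyclic off \<open>x\<close> with a free value at
  \<open>x\<close>. Such a map is acyclic, or has exactly one cycle through \<open>x\<close>;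
  sorting by that cycle gives the right side. This is the recursion of the invariant
  \<open>R\<close>.\<close>

lemma acyclic_sum_expand:
  assumes "finite U" and "x \<in> U" and N: "\<And>v. v \<in> U \<Longrightarrow> finite (N v)" and g: "\<And>v z. g v (Some z) = 1"
  shows "(\<Sum>z\<in>N x. g x z) * acyclic_sum N g (U - {x}) =
    acyclic_sum N g U + (\<Sum>Q\<in>rooted_cycles N U x. acyclic_sum N g (U - set Q))"
proof -
  let ?w = "\<lambda>f. \<Prod>v\<in>U. g v (f v)"
  let ?X = "{f \<in> PiE U N. acyclic_map (U - {x}) f}"
  let ?B = "\<lambda>Q. {f \<in> PiE U N. acyclic_map (U - {x}) f \<and> orbit f Q}"
  have finX: "finite ?X"
    using assms by (intro finite_subset[OF _ finite_PiE[of U N]]) auto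
  have finC: "finite (rooted_cycles N U x)"
    using finite_subset_distinct[OF \<open>finite U\<close>]
    by (rule rev_finite_subset) (auto simp: rooted_cycles_def)
  have "(\<Sum>z\<in>N x. g x z) * acyclic_sum N g (U - {x}) =
     (\<Sum>(z, f)\<in>N x \<times> {f \<in> PiE (U - {x}) N. acyclic_map (U - {x}) f}. g x z * (\<Prod>v\<in>U - {x}. g v (f v)))"
    by (simp add: acyclic_sum_def sum_product sum.cartesian_product)
  also have "\<dots> = (\<Sum>f\<in>?X. ?w f)"
  proof (rule sum.reindex_bij_witness[where j = "\<lambda>(z, f). f(x := z)" and i = "\<lambda>f. (f x, restrict f (U - {x}))"])
    fix p assume "p \<in> N x \<times> {f \<in> PiE (U - {x}) N. acyclic_map (U - {x}) f}"
    then obtain z f where p: "p = (z, f)" "z \<in> N x" "f \<in> PiE (U - {x}) N" "acyclic_map (U - {x}) f"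
      by auto
    show "(\<lambda>f. (f x, restrict f (U - {x}))) ((\<lambda>(z, f). f(x := z)) p) = p"
      using p by (auto simp: fun_eq_iff PiE_iff extensional_def)
    have "acyclic_map (U - {x}) (f(x := z))"
      using p(4) by (subst acyclic_map_cong[where g = f]) auto
    then show "(\<lambda>(z, f). f(x := z)) p \<in> ?X"
      using p \<open>x \<in> U\<close> by (auto simp: PiE_iff extensional_def)
    have "(\<Prod>v\<in>U. g v ((f(x := z)) v)) = g x z * (\<Prod>v\<in>U - {x}. g v ((f(x := z)) v))"
      using assms(1,2) by (subst prod.remove[of U x]) auto
    also have "\<dots> = g x z * (\<Prod>v\<in>U - {x}. g v (f v))"
      by (intro arg_cong2[where f="(*)"] prod.cong) auto
    finally show "?w ((\<lambda>(z, f). f(x := z)) p) = (case p of (z, f) \<Rightarrow> g x z * (\<Prod>v\<in>U - {x}. g v (f v)))"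
      using p by simp
  next
    fix f assume f: "f \<in> ?X"
    show "(\<lambda>(z, f). f(x := z)) ((\<lambda>f. (f x, restrict f (U - {x}))) f) = f"
      using f by (auto simp: fun_eq_iff PiE_iff extensional_def)
    have "acyclic_map (U - {x}) (restrict f (U - {x}))"
      using f by (subst acyclic_map_cong[where g = f]) auto
    then show "(\<lambda>f. (f x, restrict f (U - {x}))) f \<in> N x \<times> {f \<in> PiE (U - {x}) N. acyclic_map (U - {x}) f}"
      using f \<open>x \<in> U\<close> by (auto simp: PiE_iff)
  qed
  \<comment> \<open>The cycle exists by \<open>obtain_orbit\<close>; the pieces are disjoint by
    \<open>orbit_unique\<close>, which is used further below.\<close>
  also have "?X = {f \<in> PiE U N. acyclic_map U f} \<union> (\<Union>Q\<in>rooted_cycles N U x. ?B Q)" (is "_ = ?A \<union> ?C")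
  proof (intro equalityI subsetI)
    fix f assume f: "f \<in> ?X"
    show "f \<in> ?A \<union> ?C"
    proof (cases "acyclic_map U f")
      case False
      then obtain Q where Q: "Q \<noteq> []" "hd Q = x" "distinct Q" "set Q \<subseteq> U" "orbit f Q"
        using f obtain_orbit[OF \<open>finite U\<close>] by blast
      have "Some (Q ! (Suc i mod length Q)) \<in> N (Q ! i)" if "i < length Q" for i
      proof -
        have "f (Q ! i) \<in> N (Q ! i)"
          using f nth_mem[OF that] Q(4) by (auto simp: PiE_iff)
        then show ?thesis using Q(5) that by (simp add: orbit_def)
      qed
      then have "Q \<in> rooted_cycles N U x"
        using Q by (auto simp: rooted_cycles_def)
      then show ?thesis using f Q(5) by auto
    qed (use f in auto)
  qed (auto intro: acyclic_map_subset)
  also have "(\<Sum>f\<in>?A \<union> ?C. ?w f) = (\<Sum>f\<in>?A. ?w f) + (\<Sum>f\<in>?C. ?w f)"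
  proof (rule sum.union_disjoint)
    show "?A \<inter> ?C = {}"
      using orbit_not_acyclic_map by (auto simp: rooted_cycles_def)
    show "finite ?A"
      by (rule finite_subset[OF _ finX]) (auto intro: acyclic_map_subset)
    show "finite ?C"
      by (rule finite_subset[OF _ finX]) auto
  qed
  also have "(\<Sum>f\<in>?C. ?w f) = (\<Sum>Q\<in>rooted_cycles N U x. \<Sum>f\<in>?B Q. ?w f)"
  proof (rule sum.UNION_disjoint[OF finC])
    show "\<forall>Q\<in>rooted_cycles N U x. finite (?B Q)"
      by (auto intro: finite_subset[OF _ finX])
    show "\<forall>Q\<in>rooted_cycles N U x. \<forall>Q'\<in>rooted_cycles N U x. Q \<noteq> Q' \<longrightarrow> ?B Q \<inter> ?B Q' = {}"
    proof (intro ballI impI)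
      fix Q Q' assume "Q \<in> rooted_cycles N U x" "Q' \<in> rooted_cycles N U x" "Q \<noteq> Q'"
      then show "?B Q \<inter> ?B Q' = {}"
        using orbit_unique[of _ Q Q'] by (auto simp: rooted_cycles_def)
    qed
  qed
  also have "\<dots> = (\<Sum>Q\<in>rooted_cycles N U x. acyclic_sum N g (U - set Q))"
    using assms by (intro sum.cong refl acyclic_sum_orbit)
  finally show ?thesis by (simp add: acyclic_sum_def)
qed

section \<open>The invariant of weighted graphs\<close>

lemma adjacent_sym: "adjacent G u v \<Longrightarrow> adjacent G v u"
  unfolding adjacent_def by (metis insert_commute)

lemma adjacent_commute: "adjacent G u v \<longleftrightarrow> adjacent G v u"
  by (auto intro: adjacent_sym)

lemma simple_graph_adjacentD:
  assumes "simple_graph G" "adjacent G u v"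
  shows "u \<in> verts G" "v \<in> verts G" "u \<noteq> v"
proof -
  obtain e where "e \<in> edges G" "ends G e = {u, v}" using assms(2) by (auto simp: adjacent_def)
  then have "{u, v} \<subseteq> verts G" "card {u, v} = 2" using assms(1) by (auto simp: simple_graph_def)
  then show "u \<in> verts G" "v \<in> verts G" "u \<noteq> v" by auto
qed

lemma neighbors_subset: "simple_graph G \<Longrightarrow> neighbors G v \<subseteq> verts G"
  by (auto simp: neighbors_def dest: simple_graph_adjacentD)

lemma finite_neighbors: "simple_graph G \<Longrightarrow> finite (neighbors G v)"
  by (rule finite_subset[OF neighbors_subset]) (auto simp: simple_graph_def)

lemma verts_delete_verts [simp]: "verts (delete_verts G S) = verts G - S"
  by (simp add: delete_verts_def)

lemma adjacent_delete_verts [simp]: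
  "adjacent (delete_verts G S) u v \<longleftrightarrow> adjacent G u v \<and> u \<notin> S \<and> v \<notin> S"
  by (auto simp: adjacent_def delete_verts_def)

lemma delete_verts_delete_verts [simp]:
  "delete_verts (delete_verts G S) T = delete_verts G (S \<union> T)"
  by (auto simp: delete_verts_def)

lemma delete_verts_empty [simp]: "delete_verts G {} = G"
  by (simp add: delete_verts_def)

lemma simple_graph_delete_verts: "simple_graph G \<Longrightarrow> simple_graph (delete_verts G S)"
  by (auto simp: simple_graph_def delete_verts_def inj_on_def)

lemma finite_simple_paths: "simple_graph G \<Longrightarrow> finite (simple_paths G x u)"
  by (rule finite_subset[OF _ finite_subset_distinct[of "verts G"]])
     (auto simp: simple_paths_def simple_graph_def)

text \<open>A path from \<open>x\<close> to a neighbour closes up through the edge back to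
  \<open>x\<close>, and the neighbour is recovered as the last vertex of the list.\<close>

lemma sum_closed_paths_eq_sum_rooted_cycles:
  assumes G: "simple_graph G"
    and N: "\<And>u v. u \<in> verts G \<Longrightarrow> v \<in> verts G \<Longrightarrow> Some v \<in> N u \<longleftrightarrow> adjacent G u v"
  shows "(\<Sum>z\<in>neighbors G x. \<Sum>Q\<in>simple_paths G x z. F Q) = (\<Sum>Q\<in>rooted_cycles N (verts G) x. F Q)"
proof -
  have "(\<Sum>z\<in>neighbors G x. \<Sum>Q\<in>simple_paths G x z. F Q) =
      (\<Sum>Q\<in>(\<Union>z\<in>neighbors G x. simple_paths G x z). F Q)"
    using finite_neighbors[OF G] finite_simple_paths[OF G]
    by (intro sum.UNION_disjoint[symmetric]) (auto simp: simple_paths_def)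
  also have "(\<Union>z\<in>neighbors G x. simple_paths G x z) = rooted_cycles N (verts G) x"
  proof -
    have "(successively (adjacent G) Q \<and> adjacent G x (last Q)) \<longleftrightarrow>
       (\<forall>i<length Q. Some (Q ! (Suc i mod length Q)) \<in> N (Q ! i))"
      if Q: "Q \<noteq> []" "hd Q = x" "set Q \<subseteq> verts G" for Q
    proof -
      obtain m where m: "length Q = Suc m" using Q by (cases Q) auto
      have V: "Q ! i \<in> verts G" if "i < length Q" for i using that Q(3) by auto
      have "(\<forall>i<length Q. Some (Q ! (Suc i mod length Q)) \<in> N (Q ! i)) \<longleftrightarrow>
        (\<forall>i<length Q. adjacent G (Q ! i) (Q ! (Suc i mod length Q)))"
        by (simp add: N[OF V V] m)
      \<comment> \<open>Only the last index \<open>m\<close> wraps around; it accounts for the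
        closing edge, the others for the edges of the path.\<close>
      also have "\<dots> \<longleftrightarrow> (\<forall>i<m. adjacent G (Q ! i) (Q ! Suc i)) \<and> adjacent G (Q ! m) (Q ! 0)"
        unfolding m less_Suc_eq by (auto simp: mod_less)
      also have "\<dots> \<longleftrightarrow> (successively (adjacent G) Q \<and> adjacent G x (last Q))"
        using Q m adjacent_commute[of G x] by (auto simp: successively_conv_nth last_conv_nth hd_conv_nth)
      finally show ?thesis by simp
    qed
    then show ?thesis
      by (auto simp: simple_paths_def rooted_cycles_def neighbors_def)
  qed
  finally show ?thesis .
qed

lemma rooted_cycles_cong:
  assumes "\<And>u v. u \<in> U \<Longrightarrow> v \<in> U \<Longrightarrow> Some v \<in> N u \<longleftrightarrow> Some v \<in> N' u"
  shows "rooted_cycles N U x = rooted_cycles N' U x"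
proof -
  have "(\<forall>i<length Q. Some (Q ! (Suc i mod length Q)) \<in> N (Q ! i)) \<longleftrightarrow>
    (\<forall>i<length Q. Some (Q ! (Suc i mod length Q)) \<in> N' (Q ! i))" if "set Q \<subseteq> U" for Q
  proof -
    have U: "Q ! i \<in> U" if "i < length Q" for i using \<open>set Q \<subseteq> U\<close> that by auto
    have "Suc i mod length Q < length Q" if "i < length Q" for i
      using that by (intro mod_less_divisor) auto
    then show ?thesis by (simp add: assms[OF U U])
  qed
  then show ?thesis unfolding rooted_cycles_def by blast
qed

lemma acyclic_sum_empty [simp]: "acyclic_sum N g {} = 1"
proof -
  have "{f \<in> PiE {} N. acyclic_map {} f} = {\<lambda>_. undefined}"
    by (auto simp: acyclic_map_def)
  then show ?thesis by (simp add: acyclic_sum_def)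
qed

text \<open>Only the row sums and the arcs inside \<open>U\<close> matter: arcs leaving \<open>U\<close> all act as exits.\<close>

lemma acyclic_sum_cong:
  assumes "finite U"
    and "\<And>v. v \<in> U \<Longrightarrow> finite (N v)" "\<And>v. v \<in> U \<Longrightarrow> finite (N' v)"
    and "\<And>v z. g v (Some z) = 1" "\<And>v z. g' v (Some z) = 1"
    and "\<And>u v. u \<in> U \<Longrightarrow> v \<in> U \<Longrightarrow> Some v \<in> N u \<longleftrightarrow> Some v \<in> N' u"
    and "\<And>v. v \<in> U \<Longrightarrow> (\<Sum>z\<in>N v. g v z) = (\<Sum>z\<in>N' v. g' v z)"
  shows "acyclic_sum N g U = acyclic_sum N' g' U"
  using assms
proof (induction "card U" arbitrary: U rule: less_induct)
  case less
  show ?case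
  proof (cases "U = {}")
    case False
    then obtain x where x: "x \<in> U" by blast
    \<comment> \<open>Both sides obey the expansion at \<open>x\<close>, and every term of it
      removes a set containing \<open>x\<close>, so induction on the number of vertices
      applies.\<close>
    have IH: "acyclic_sum N g (U - S) = acyclic_sum N' g' (U - S)" if "x \<in> S" for S
    proof (rule less.hyps)
      show "card (U - S) < card U"
        using x that less.prems(1) by (intro psubset_card_mono) auto
    qed (use less.prems in auto)
    have "x \<in> set Q" if "Q \<in> rooted_cycles N U x" for Q
      using that hd_in_set by (fastforce simp: rooted_cycles_def)
    then have "(\<Sum>Q\<in>rooted_cycles N U x. acyclic_sum N g (U - set Q)) =
      (\<Sum>Q\<in>rooted_cycles N' U x. acyclic_sum N' g' (U - set Q))"
      using rooted_cycles_cong[of U N N' x] less.prems by (auto intro!: sum.cong IH)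
    moreover have "(\<Sum>z\<in>N x. g x z) * acyclic_sum N g (U - {x}) =
       (\<Sum>z\<in>N' x. g' x z) * acyclic_sum N' g' (U - {x})"
      using IH[of "{x}"] less.prems(7)[OF x] by simp
    ultimately show ?thesis
      using acyclic_sum_expand[of U x N g] acyclic_sum_expand[of U x N' g'] x less.prems by simp
  qed simp
qed

text \<open>Uniqueness: the relations compute \<open>f\<close> by recursion on the number of
  vertices, and acyclic sums obey the same recursion. \<open>N\<close> and \<open>g\<close> are kept
  general so that exits can be modelled by weights on \<open>None\<close> or by arcs leaving the
  vertex set.\<close>

lemma R_relations_eq_acyclic_sum:
  assumes f: "R_relations f" and "simple_graph G"
    and "\<And>v. v \<in> verts G \<Longrightarrow> finite (N v)"
    and "\<And>v z. g v (Some z) = 1"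
    and "\<And>u v. u \<in> verts G \<Longrightarrow> v \<in> verts G \<Longrightarrow> Some v \<in> N u \<longleftrightarrow> adjacent G u v"
    and "\<And>v. v \<in> verts G \<Longrightarrow> (\<Sum>z\<in>N v. g v z) = w v"
  shows "f G w = acyclic_sum N g (verts G)"
  using assms(2-)
proof (induction "card (verts G)" arbitrary: G rule: less_induct)
  case less
  have fin: "finite (verts G)" using less.prems by (simp add: simple_graph_def)
  show ?case
  proof (cases "verts G = {}")
    case True
    then show ?thesis using f less.prems(1) by (simp add: R_relations_def)
  next
    case False
    then obtain x where x: "x \<in> verts G" by blast
    have IH: "f (delete_verts G S) w = acyclic_sum N g (verts G - S)" if "x \<in> S" for S
    proof -
      have "f (delete_verts G S) w = acyclic_sum N g (verts (delete_verts G S))"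
      proof (rule less.hyps)
        show "card (verts (delete_verts G S)) < card (verts G)"
          using x that fin by (intro psubset_card_mono) auto
      qed (use less.prems in \<open>auto simp: simple_graph_delete_verts\<close>)
      then show ?thesis by simp
    qed
    have "f G w = w x * f (delete_verts G {x}) w
           - (\<Sum>z\<in>neighbors G x. \<Sum>Q\<in>simple_paths G x z. f (delete_verts G (set Q)) w)"
      using f less.prems(1) x by (simp add: R_relations_def)
    also have "(\<Sum>z\<in>neighbors G x. \<Sum>Q\<in>simple_paths G x z. f (delete_verts G (set Q)) w) =
      (\<Sum>Q\<in>rooted_cycles N (verts G) x. f (delete_verts G (set Q)) w)"
      using less.prems by (intro sum_closed_paths_eq_sum_rooted_cycles) auto
    also have "\<dots> = (\<Sum>Q\<in>rooted_cycles N (verts G) x. acyclic_sum N g (verts G - set Q))"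
      using hd_in_set by (intro sum.cong refl IH) (fastforce simp: rooted_cycles_def)
    also have "w x * f (delete_verts G {x}) w - \<dots> = acyclic_sum N g (verts G)"
      using acyclic_sum_expand[of "verts G" x N g] fin x less.prems IH[of "{x}"] by simp
    finally show ?thesis .
  qed
qed

text \<open>The invariant is chosen by \<open>SOME\<close>, so a solution must be exhibited; acyclic
  sums provide one.\<close>

lemma R_relations_R_invariant: "R_relations (R_invariant :: ('v, 'e) multigraph \<Rightarrow> ('v \<Rightarrow> real) \<Rightarrow> real)"
proof -
  define N where "N = (\<lambda>(G :: ('v, 'e) multigraph) v. insert None (Some ` neighbors G v))"
  \<comment> \<open>The exit receives the weight minus the degree, possibly negative, so that the
    row sum at \<open>v\<close> is \<open>w v\<close>.\<close>
  define g where "g = (\<lambda>(G :: ('v, 'e) multigraph) w v (z :: 'v option).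
    case z of None \<Rightarrow> w v - real (vertex_degree G v) | Some _ \<Rightarrow> (1 :: real))"
  define f where "f = (\<lambda>(G :: ('v, 'e) multigraph) w. acyclic_sum (N G) (g G w) (verts G))"
  have finN: "finite (N G v)" if "simple_graph G" for G v
    using finite_neighbors[OF that] by (simp add: N_def)
  have rows: "(\<Sum>z\<in>N G v. g G w v z) = w v" if "simple_graph G" for G w v
    using finite_neighbors[OF that]
    by (simp add: N_def g_def sum.insert_if image_iff sum.reindex vertex_degree_def)
  have adj: "Some z \<in> N G v \<longleftrightarrow> adjacent G v z" for G v z
    by (auto simp: N_def neighbors_def)
  have g1: "g G w v (Some z) = 1" for G w v z
    by (simp add: g_def)
  \<comment> \<open>Deletion changes neighbour sets and exit weights, but neither the row sums nor
    the arcs among the remaining vertices; hence \<open>acyclic_sum_cong\<close> allows the data of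
    \<open>G\<close> to be kept throughout the recursion.\<close>
  have del: "f (delete_verts G S) w = acyclic_sum (N G) (g G w) (verts G - S)" if "simple_graph G" for G w S
  proof -
    have "finite (verts G - S)" using that by (simp add: simple_graph_def)
    then show ?thesis
      unfolding f_def verts_delete_verts
      using that simple_graph_delete_verts[OF that, of S]
      by (intro acyclic_sum_cong) (auto simp: rows finN adj g1)
  qed
  have "f G w = w x * f (delete_verts G {x}) w
           - (\<Sum>z\<in>neighbors G x. \<Sum>Q\<in>simple_paths G x z. f (delete_verts G (set Q)) w)"
    if G: "simple_graph G" and x: "x \<in> verts G" for G w x
  proof -
    have "(\<Sum>z\<in>neighbors G x. \<Sum>Q\<in>simple_paths G x z. f (delete_verts G (set Q)) w) =
      (\<Sum>Q\<in>rooted_cycles (N G) (verts G) x. acyclic_sum (N G) (g G w) (verts G - set Q))"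
      unfolding del[OF G] using G by (intro sum_closed_paths_eq_sum_rooted_cycles) (auto simp: adj)
    then show ?thesis
      using acyclic_sum_expand[of "verts G" x "N G" "g G w"] x finN[OF G] g1 rows[OF G] G
      by (simp add: del[OF G] simple_graph_def) (simp add: f_def)
  qed
  then have "R_relations f"
    by (auto simp: R_relations_def f_def)
  then show ?thesis
    unfolding R_invariant_def by (rule someI[of R_relations])
qed

lemma R_invariant_expand:
  assumes "simple_graph G" "x \<in> verts G"
  shows "w x * R_invariant (delete_verts G {x}) w = R_invariant G w
     + (\<Sum>z\<in>neighbors G x. \<Sum>Q\<in>simple_paths G x z. R_invariant (delete_verts G (set Q)) w)"
proof -
  have "R_invariant G w = w x * R_invariant (delete_verts G {x}) w
     - (\<Sum>z\<in>neighbors G x. \<Sum>Q\<in>simple_paths G x z. R_invariant (delete_verts G (set Q)) w)"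
    using R_relations_R_invariant assms unfolding R_relations_def by blast
  then show ?thesis by simp
qed

text \<open>The value \<open>None\<close> is excluded: the exits are the arcs to neighbours outside
  \<open>U\<close>.\<close>

definition acyclic_maps :: "('v, 'e) multigraph \<Rightarrow> 'v set \<Rightarrow> ('v \<Rightarrow> 'v option) set" where
  "acyclic_maps G U = {f \<in> PiE U (\<lambda>v. Some ` neighbors G v). acyclic_map U f}"

text \<open>With degrees of the full graph as weights, the arcs into \<open>S\<close> make up
  exactly the missing row sum. All weights become one and the acyclic sum is a cardinality.\<close>

lemma R_invariant_delete_verts_degree:
  assumes "simple_graph G"
  shows "R_invariant (delete_verts G S) (\<lambda>v. real (vertex_degree G v)) =
    real (card (acyclic_maps G (verts G - S)))"
proof -
  have "Some v \<in> Some ` neighbors G u \<longleftrightarrow> adjacent G u v" for u v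
    by (auto simp: neighbors_def)
  then have "R_invariant (delete_verts G S) (\<lambda>v. real (vertex_degree G v)) =
    acyclic_sum (\<lambda>v. Some ` neighbors G v) (\<lambda>_ _. 1) (verts (delete_verts G S))"
    using assms simple_graph_delete_verts[OF assms]
    by (intro R_relations_eq_acyclic_sum[OF R_relations_R_invariant])
       (simp_all add: finite_neighbors vertex_degree_def card_image)
  then show ?thesis
    by (simp add: acyclic_sum_def acyclic_maps_def)
qed

section \<open>Path sums of the invariant as a Green function\<close>

lemma simple_paths_delete_verts:
  "simple_paths (delete_verts G S) x u = {P \<in> simple_paths G x u. set P \<inter> S = {}}"
proof -
  have "successively (adjacent (delete_verts G S)) P \<longleftrightarrow> successively (adjacent G) P" if "set P \<inter> S = {}" for P
    using that by (intro successively_cong) auto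
  then show ?thesis
    by (auto simp: simple_paths_def)
qed

lemma takeWhile_dropWhile_first:
  assumes "x \<notin> set A"
  shows "takeWhile (\<lambda>v. v \<noteq> x) (A @ x # B) = A" "dropWhile (\<lambda>v. v \<noteq> x) (A @ x # B) = x # B"
  using assms by (induction A) auto

text \<open>Expanding the invariant of \<open>H\<close> without \<open>tl P\<close> at the head
  \<open>x\<close> of \<open>P\<close> gives \<open>\<rho> (set (tl P))\<close> and one term for
  each closed path \<open>Q\<close> at \<open>x\<close> avoiding \<open>tl P\<close>. The former
  account for the paths from neighbours of \<open>x\<close> that avoid \<open>x\<close>, the latter,
  glued to \<open>tl P\<close>, for those that pass through \<open>x\<close>.\<close>

lemma R_invariant_Green_function:
  fixes H :: "('v, 'e) multigraph" and w :: "'v \<Rightarrow> real"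
  assumes H: "simple_graph H" and x: "x \<in> verts H"
  defines "\<rho> \<equiv> \<lambda>S. R_invariant (delete_verts H S) w"
  shows "w x * (\<Sum>P\<in>simple_paths H x u. \<rho> (set P)) =
    (if x = u then \<rho> {} else 0) + (\<Sum>z\<in>neighbors H x. \<Sum>P\<in>simple_paths H z u. \<rho> (set P))"
proof -
  let ?nb = "neighbors H x"
  let ?avoid = "\<lambda>z. {P \<in> simple_paths H z u. x \<notin> set P}"
  let ?visit = "\<lambda>z. {P \<in> simple_paths H z u. x \<in> set P}"
  let ?loops = "\<lambda>P. SIGMA z:neighbors (delete_verts H (set (tl P))) x. simple_paths (delete_verts H (set (tl P))) x z"
  have fin: "finite (simple_paths H a b)" "finite (neighbors H a)"
    "finite (simple_paths (delete_verts H S) a b)" "finite (neighbors (delete_verts H S) a)" for a b S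
    using H by (simp_all add: finite_simple_paths finite_neighbors simple_graph_delete_verts)
  \<comment> \<open>The recursion is applied where only the tail of \<open>P\<close> has been
    deleted, so that \<open>x\<close> is still a vertex.\<close>
  have expand: "w x * \<rho> (set P) =
      \<rho> (set (tl P)) + (\<Sum>(z, Q)\<in>?loops P. \<rho> (set (tl P) \<union> set Q))"
    if "P \<in> simple_paths H x u" for P
  proof -
    have P: "P = x # tl P" "x \<notin> set (tl P)"
      using that by (cases P; auto simp: simple_paths_def)+
    then have "set P = set (tl P) \<union> {x}" by (metis Un_commute insert_is_Un list.simps(15))
    then show ?thesis
      using R_invariant_expand[of "delete_verts H (set (tl P))" x w] H x P
      by (simp add: \<rho>_def simple_graph_delete_verts sum.Sigma fin del: insert_is_Un Un_insert_right)
  qed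
  \<comment> \<open>Dropping the head leaves a path from a neighbour that avoids \<open>x\<close>.
    If \<open>x = u\<close>, the only path is \<open>[x]\<close>, with empty tail, and no path to
    \<open>u\<close> avoids \<open>x\<close>.\<close>
  have avoiding: "(\<Sum>P\<in>simple_paths H x u. \<rho> (set (tl P))) =
     (if x = u then \<rho> {} else 0) + (\<Sum>z\<in>?nb. \<Sum>P\<in>?avoid z. \<rho> (set P))"
  proof (cases "x = u")
    case True
    have "simple_paths H x x = {[x]}"
    proof (intro equalityI subsetI)
      fix P assume "P \<in> simple_paths H x x"
      then show "P \<in> {[x]}"
        by (cases P rule: rev_cases) (auto simp: simple_paths_def hd_append split: if_splits)
    qed (use x in \<open>auto simp: simple_paths_def\<close>)
    moreover have avoid: "?avoid z = {}" for z
      using True last_in_set by (auto simp: simple_paths_def)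
    ultimately show ?thesis unfolding avoid using True by simp
  next
    case False
    have "(\<Sum>P\<in>simple_paths H x u. \<rho> (set (tl P))) = (\<Sum>(z, P)\<in>(SIGMA z:?nb. ?avoid z). \<rho> (set P))"
    proof (rule sum.reindex_bij_witness[where j = "\<lambda>P. (hd (tl P), tl P)" and i = "\<lambda>(z, P). x # P"])
      fix P assume "P \<in> simple_paths H x u"
      then obtain z B where "P = x # z # B" "x # z # B \<in> simple_paths H x u"
        using False by (cases P; cases "tl P") (auto simp: simple_paths_def)
      then show "(\<lambda>(z, P). x # P) (hd (tl P), tl P) = P" "(hd (tl P), tl P) \<in> (SIGMA z:?nb. ?avoid z)"
        "(case (hd (tl P), tl P) of (z, P) \<Rightarrow> \<rho> (set P)) = \<rho> (set (tl P))"
        by (auto simp: simple_paths_def neighbors_def)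
    next
      fix p assume "p \<in> (SIGMA z:?nb. ?avoid z)"
      then obtain z B where "p = (z, z # B)" "adjacent H x z" "z # B \<in> simple_paths H z u" "x \<notin> set (z # B)"
        by (cases p; cases "snd p") (auto simp: simple_paths_def neighbors_def)
      then show "(\<lambda>P. (hd (tl P), tl P)) ((\<lambda>(z, P). x # P) p) = p" "(\<lambda>(z, P). x # P) p \<in> simple_paths H x u"
        using x by (auto simp: simple_paths_def)
    qed
    then show ?thesis using False fin by (simp add: sum.Sigma)
  qed
  \<comment> \<open>The list \<open>rev Q @ tl P\<close> runs from \<open>z\<close> back along
    \<open>Q\<close> to \<open>x\<close> and on to \<open>u\<close>. Conversely, cutting a path from
    \<open>z\<close> at \<open>x\<close> recovers \<open>Q\<close> reversed and \<open>P\<close>;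
    the deleted vertex sets agree.\<close>
  have visiting: "(\<Sum>P\<in>simple_paths H x u. \<Sum>(z, Q)\<in>?loops P. \<rho> (set (tl P) \<union> set Q)) =
     (\<Sum>z\<in>?nb. \<Sum>P\<in>?visit z. \<rho> (set P))"
  proof -
    have "(\<Sum>P\<in>simple_paths H x u. \<Sum>(z, Q)\<in>?loops P. \<rho> (set (tl P) \<union> set Q)) =
      (\<Sum>(P, z, Q)\<in>(SIGMA P:simple_paths H x u. ?loops P). \<rho> (set (tl P) \<union> set Q))"
      using fin by (subst sum.Sigma) (auto intro!: finite_SigmaI)
    also have "\<dots> = (\<Sum>(z, P)\<in>(SIGMA z:?nb. ?visit z). \<rho> (set P))"
    proof (rule sum.reindex_bij_witness[where j = "\<lambda>(P, z, Q). (z, rev Q @ tl P)"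
          and i = "\<lambda>(z, P). (dropWhile (\<lambda>v. v \<noteq> x) P, z, rev (takeWhile (\<lambda>v. v \<noteq> x) P @ [x]))"])
      fix p assume "p \<in> (SIGMA P:simple_paths H x u. ?loops P)"
      then obtain P z Q where p: "p = (P, z, Q)" "P \<in> simple_paths H x u" "adjacent H x z"
        "Q \<in> simple_paths H x z" "set Q \<inter> set (tl P) = {}"
        by (cases p) (auto simp: neighbors_def simple_paths_delete_verts)
      obtain B where B: "P = x # B" using p(2) by (cases P) (auto simp: simple_paths_def)
      obtain A where A: "Q = x # A" using p(4) by (cases Q) (auto simp: simple_paths_def)
      have "x \<notin> set A" using p(4) A by (auto simp: simple_paths_def)
      then have "takeWhile (\<lambda>v. v \<noteq> x) (rev A @ x # B) = rev A" "dropWhile (\<lambda>v. v \<noteq> x) (rev A @ x # B) = x # B"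
        using takeWhile_dropWhile_first[of x "rev A" B] by simp_all
      then show "(\<lambda>(z, P). (dropWhile (\<lambda>v. v \<noteq> x) P, z, rev (takeWhile (\<lambda>v. v \<noteq> x) P @ [x])))
          ((\<lambda>(P, z, Q). (z, rev Q @ tl P)) p) = p"
        using p(1) A B by simp
      have "successively (adjacent H) (rev Q)"
        using p(4) by (auto simp: simple_paths_def successively_rev adjacent_commute cong: successively_cong)
      then have "successively (adjacent H) (rev Q @ B)"
        using p(2) B A by (cases B) (auto simp: successively_append_iff simple_paths_def)
      moreover have "last (rev Q @ B) = u"
        using p(2) A B by (auto simp: simple_paths_def last_append split: if_splits)
      moreover have "hd (rev Q @ B) = z"
        using p(4) by (auto simp: simple_paths_def hd_append hd_rev)
      moreover have "distinct (rev Q @ B)" "set (rev Q @ B) \<subseteq> verts H"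
        using p B by (auto simp: simple_paths_def)
      ultimately show "(\<lambda>(P, z, Q). (z, rev Q @ tl P)) p \<in> (SIGMA z:?nb. ?visit z)"
        using p A B by (auto simp: simple_paths_def neighbors_def)
      show "(case (\<lambda>(P, z, Q). (z, rev Q @ tl P)) p of (z, P) \<Rightarrow> \<rho> (set P)) =
         (case p of (P, z, Q) \<Rightarrow> \<rho> (set (tl P) \<union> set Q))"
        using p(1) by (simp add: Un_commute)
    next
      fix p assume "p \<in> (SIGMA z:?nb. ?visit z)"
      then obtain z P where p: "p = (z, P)" "adjacent H x z" "P \<in> simple_paths H z u" "x \<in> set P"
        by (auto simp: neighbors_def)
      obtain A B where AB: "P = A @ x # B" "x \<notin> set A"
        using split_list_first[OF p(4)] by blast
      have tw: "takeWhile (\<lambda>v. v \<noteq> x) P = A" "dropWhile (\<lambda>v. v \<noteq> x) P = x # B"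
        using takeWhile_dropWhile_first[of x A B] AB by simp_all
      show "(\<lambda>(P, z, Q). (z, rev Q @ tl P)) ((\<lambda>(z, P). (dropWhile (\<lambda>v. v \<noteq> x) P, z, rev (takeWhile (\<lambda>v. v \<noteq> x) P @ [x]))) p) = p"
        using p(1) tw AB by simp
      have "x # B \<in> simple_paths H x u"
        using p(3) AB by (auto simp: simple_paths_def successively_append_iff)
      moreover have "x # rev A \<in> simple_paths H x z"
      proof -
        have "successively (adjacent H) (A @ [x])"
          using p(3) AB by (auto simp: simple_paths_def successively_append_iff)
        then have "successively (adjacent H) (rev (A @ [x]))"
          unfolding successively_rev by (rule successively_mono) (auto intro: adjacent_sym)
        moreover have "last (x # rev A) = z"
          using p(3) AB by (cases A) (auto simp: simple_paths_def)
        ultimately show ?thesis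
          using p(3) AB by (auto simp: simple_paths_def)
      qed
      moreover have "set (x # rev A) \<inter> set B = {}" "x \<notin> set B"
        using p(3) AB by (auto simp: simple_paths_def)
      moreover have "z \<notin> set B"
        using \<open>set (x # rev A) \<inter> set B = {}\<close> p(3) AB by (cases A) (auto simp: simple_paths_def)
      ultimately show "(\<lambda>(z, P). (dropWhile (\<lambda>v. v \<noteq> x) P, z, rev (takeWhile (\<lambda>v. v \<noteq> x) P @ [x]))) p
          \<in> (SIGMA P:simple_paths H x u. ?loops P)"
        using p(1,2) tw by (auto simp: neighbors_def simple_paths_delete_verts)
    qed
    also have "\<dots> = (\<Sum>z\<in>?nb. \<Sum>P\<in>?visit z. \<rho> (set P))"
      using fin by (simp add: sum.Sigma)
    finally show ?thesis .
  qed
  have split: "(\<Sum>P\<in>simple_paths H z u. \<rho> (set P)) = (\<Sum>P\<in>?avoid z. \<rho> (set P)) + (\<Sum>P\<in>?visit z. \<rho> (set P))" for z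
    using fin by (subst sum.union_disjoint[symmetric]) (auto intro!: sum.cong)
  have "w x * (\<Sum>P\<in>simple_paths H x u. \<rho> (set P)) =
      (\<Sum>P\<in>simple_paths H x u. \<rho> (set (tl P)) + (\<Sum>(z, Q)\<in>?loops P. \<rho> (set (tl P) \<union> set Q)))"
    unfolding sum_distrib_left by (intro sum.cong refl expand)
  also have "\<dots> = (if x = u then \<rho> {} else 0) + (\<Sum>z\<in>?nb. \<Sum>P\<in>?avoid z. \<rho> (set P))
      + (\<Sum>z\<in>?nb. \<Sum>P\<in>?visit z. \<rho> (set P))"
    by (simp only: sum.distrib avoiding visiting)
  also have "\<dots> = (if x = u then \<rho> {} else 0) + (\<Sum>z\<in>?nb. \<Sum>P\<in>simple_paths H z u. \<rho> (set P))"
    by (simp only: split sum.distrib add.assoc)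
  finally show ?thesis .
qed

section \<open>Spanning trees of quotients\<close>

lemma rtranclp_obtain_distinct_path:
  assumes "r\<^sup>*\<^sup>* x y"
  obtains xs where "xs \<noteq> []" "hd xs = x" "last xs = y" "distinct xs" "successively r xs"
proof -
  have "\<exists>xs. xs \<noteq> [] \<and> hd xs = x \<and> last xs = y \<and> distinct xs \<and> successively r xs"
    using assms
  proof (induction rule: converse_rtranclp_induct)
    case base
    show ?case by (intro exI[of _ "[y]"]) simp
  next
    case (step x x')
    then obtain xs where xs: "xs \<noteq> []" "hd xs = x'" "last xs = y" "distinct xs" "successively r xs"
      by blast
    show ?case
    proof (cases "x \<in> set xs")
      case True
      then obtain A B where "xs = A @ x # B" by (meson split_list)
      then show ?thesis
        using xs by (intro exI[of _ "x # B"]) (auto simp: successively_append_iff)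
    next
      case False
      then show ?thesis
        using xs step.hyps by (intro exI[of _ "x # xs"]) (cases xs; auto)
    qed
  qed
  then show thesis using that by blast
qed

text \<open>Covers the contraction of \<open>S\<close> and, with \<open>S = {y}\<close> and the
  identity as \<open>cls\<close>, the graph itself, so that one bijection counts the spanning trees
  of both. Edges of \<open>K\<close> are edges of \<open>G\<close>, which lets a tree of
  \<open>K\<close> be read in \<open>G\<close>.\<close>

locale rooted_quotient =
  fixes G :: "('v, 'e) multigraph" and K :: "('k, 'e) multigraph" and S :: "'v set" and cls :: "'v \<Rightarrow> 'k"
  assumes simple: "simple_graph G"
    and S_subset: "S \<subseteq> verts G" and S_nonempty: "S \<noteq> {}"
    and verts_K: "verts K = cls ` verts G"
    and edges_K: "edges K = {e \<in> edges G. \<not> ends G e \<subseteq> S}"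
    and ends_K: "\<And>e. e \<in> edges K \<Longrightarrow> ends K e = cls ` ends G e"
    and cls_eq_iff: "\<And>u v. u \<in> verts G \<Longrightarrow> v \<in> verts G \<Longrightarrow> cls u = cls v \<longleftrightarrow> u = v \<or> (u \<in> S \<and> v \<in> S)"
begin

definition U :: "'v set" where "U = verts G - S"

definition edge :: "'v \<Rightarrow> 'v \<Rightarrow> 'e" where "edge a b = (THE e. e \<in> edges G \<and> ends G e = {a, b})"

definition tree_of :: "('v \<Rightarrow> 'v option) \<Rightarrow> 'e set" where "tree_of f = (\<lambda>v. edge v (the (f v))) ` U"

definition root :: 'k where "root = cls (SOME s. s \<in> S)"

lemma cls_root: "s \<in> S \<Longrightarrow> cls s = root"
  unfolding root_def using cls_eq_iff S_subset someI[of "\<lambda>s. s \<in> S" s] by auto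

lemma finite_verts: "finite (verts G)"
  using simple by (simp add: simple_graph_def)

lemma edgeI: "e \<in> edges G \<Longrightarrow> ends G e = {a, b} \<Longrightarrow> edge a b = e"
  unfolding edge_def using simple by (intro the_equality) (auto simp: simple_graph_def inj_on_def)

lemma adjacent_edge:
  assumes "adjacent G a b"
  shows "edge a b \<in> edges G" "ends G (edge a b) = {a, b}"
proof -
  obtain e where "e \<in> edges G" "ends G e = {a, b}" using assms by (auto simp: adjacent_def)
  then show "edge a b \<in> edges G" "ends G (edge a b) = {a, b}" using edgeI by auto
qed

lemma edge_K:
  assumes "adjacent G a b" "a \<in> U"
  shows "edge a b \<in> edges K" "ends K (edge a b) = {cls a, cls b}"
proof -
  show "edge a b \<in> edges K"
    using adjacent_edge[OF assms(1)] assms(2) by (auto simp: edges_K U_def)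
  then show "ends K (edge a b) = {cls a, cls b}"
    using adjacent_edge[OF assms(1)] by (simp add: ends_K)
qed

section \<open>The bijection between acyclic maps and spanning trees\<close>

lemma acyclic_maps_D:
  assumes "f \<in> acyclic_maps G U" "v \<in> U"
  obtains z where "f v = Some z" "adjacent G v z" "z \<in> verts G"
    "edge v z \<in> tree_of f" "edge v z \<in> edges K" "ends K (edge v z) = {cls v, cls z}"
proof -
  have "f v \<in> Some ` neighbors G v" using assms by (auto simp: acyclic_maps_def PiE_iff)
  then obtain z where z: "f v = Some z" "adjacent G v z" by (auto simp: neighbors_def)
  moreover have "edge v z \<in> tree_of f" using z assms(2) by (force simp: tree_of_def)
  ultimately show thesis
    using that simple_graph_adjacentD[OF simple] edge_K assms(2) by blast
qed

lemma acyclic_mapsD: "f \<in> acyclic_maps G U \<Longrightarrow> W \<subseteq> U \<Longrightarrow> W \<noteq> {} \<Longrightarrow> \<exists>v\<in>W. f v \<notin> Some ` W"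
  by (simp add: acyclic_maps_def acyclic_map_def)

lemma tree_of_subset: "f \<in> acyclic_maps G U \<Longrightarrow> tree_of f \<subseteq> edges K"
proof
  fix e assume f: "f \<in> acyclic_maps G U" and "e \<in> tree_of f"
  then obtain v where v: "v \<in> U" "e = edge v (the (f v))" by (auto simp: tree_of_def)
  obtain z where "f v = Some z" "edge v z \<in> edges K" by (rule acyclic_maps_D[OF f v(1)])
  then show "e \<in> edges K" using v(2) by simp
qed

text \<open>Among the vertices of \<open>U\<close> whose class fails to reach the root, acyclicity
  gives one that is mapped outside this set, hence to a vertex whose class does reach the
  root.\<close>

lemma tree_of_reaches_root:
  assumes f: "f \<in> acyclic_maps G U" and "v \<in> verts G"
  shows "(adjacent (K\<lparr>edges := tree_of f\<rparr>))\<^sup>*\<^sup>* (cls v) root"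
proof (rule ccontr)
  let ?r = "(adjacent (K\<lparr>edges := tree_of f\<rparr>))\<^sup>*\<^sup>*"
  assume "\<not> ?r (cls v) root"
  define B where "B = {v \<in> U. \<not> ?r (cls v) root}"
  have "v \<in> B"
    using \<open>\<not> ?r (cls v) root\<close> assms(2) cls_root by (auto simp: B_def U_def)
  then obtain b where b: "b \<in> B" "f b \<notin> Some ` B"
    using acyclic_mapsD[OF f, of B] by (auto simp: B_def)
  then have "b \<in> U" by (simp add: B_def)
  obtain z where z: "f b = Some z" "z \<in> verts G" "edge b z \<in> tree_of f"
      "ends K (edge b z) = {cls b, cls z}"
    by (rule acyclic_maps_D[OF f \<open>b \<in> U\<close>])
  have "adjacent (K\<lparr>edges := tree_of f\<rparr>) (cls b) (cls z)"
    using z by (auto simp: adjacent_def)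
  moreover have "?r (cls z) root"
    using z b cls_root by (cases "z \<in> S") (auto simp: B_def U_def)
  ultimately show False
    using b(1) by (auto simp: B_def intro: converse_rtranclp_into_rtranclp)
qed

lemma connected_tree_of:
  assumes "f \<in> acyclic_maps G U"
  shows "connected_graph (K\<lparr>edges := tree_of f\<rparr>)"
proof -
  let ?a = "adjacent (K\<lparr>edges := tree_of f\<rparr>)"
  have "symp ?a" by (rule sympI) (rule adjacent_sym)
  then have sym: "?a\<^sup>*\<^sup>* u v \<Longrightarrow> ?a\<^sup>*\<^sup>* v u" for u v
    using symp_rtranclp[of ?a] by (auto dest: sympD)
  show ?thesis
    unfolding connected_graph_def
  proof (intro ballI)
    fix p q assume "p \<in> verts (K\<lparr>edges := tree_of f\<rparr>)" "q \<in> verts (K\<lparr>edges := tree_of f\<rparr>)"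
    then have "?a\<^sup>*\<^sup>* p root" "?a\<^sup>*\<^sup>* q root"
      using tree_of_reaches_root[OF assms] by (auto simp: verts_K)
    then show "?a\<^sup>*\<^sup>* p q" using sym by (meson rtranclp_trans)
  qed
qed

text \<open>A cycle with \<open>n\<close> vertices has \<open>n\<close> edges, each contributed by a distinct one of its vertices;
  so the cycle is closed under the map.\<close>

lemma tree_of_no_cycle:
  assumes f: "f \<in> acyclic_maps G U"
  shows "\<not> is_cycle (K\<lparr>edges := tree_of f\<rparr>) vs es"
proof
  assume "is_cycle (K\<lparr>edges := tree_of f\<rparr>) vs es"
  then have c: "vs \<noteq> []" "length es = length vs" "distinct vs" "distinct es"
    "\<And>i. i < length vs \<Longrightarrow> es ! i \<in> tree_of f"
    "\<And>i. i < length vs \<Longrightarrow> ends K (es ! i) = {vs ! i, vs ! (Suc i mod length vs)}"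
    by (auto simp: is_cycle_def)
  have "\<forall>i\<in>{..<length vs}. \<exists>v. v \<in> U \<and> es ! i = edge v (the (f v))"
    using c(5) by (auto simp: tree_of_def)
  then obtain own where own: "\<And>i. i < length vs \<Longrightarrow> own i \<in> U"
    "\<And>i. i < length vs \<Longrightarrow> es ! i = edge (own i) (the (f (own i)))"
    unfolding bchoice_iff by auto
  define W where "W = own ` {..<length vs}"
  have "inj_on own {..<length vs}"
    by (rule inj_onI) (metis c(2,4) lessThan_iff nth_eq_iff_index_eq own(2))
  then have cardW: "card W = length vs" by (simp add: W_def card_image)
  have WU: "W \<subseteq> U" using own(1) by (auto simp: W_def)
  have ends: "ends K (es ! i) \<subseteq> set vs" if "i < length vs" for i
  proof -
    have "Suc i mod length vs < length vs" using that by (intro mod_less_divisor) auto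
    then show ?thesis using c(6)[OF that] that by simp
  qed
  have cls: "cls v \<in> set vs \<and> (\<exists>z\<in>verts G. f v = Some z \<and> cls z \<in> set vs)" if v: "v \<in> W" for v
  proof -
    obtain i where i: "i < length vs" "v = own i" using v by (auto simp: W_def)
    obtain z where "f v = Some z" "z \<in> verts G" "ends K (edge v z) = {cls v, cls z}"
      by (rule acyclic_maps_D[OF f subsetD[OF WU v]])
    then show ?thesis using ends[OF i(1)] own(2)[OF i(1)] i by auto
  qed
  \<comment> \<open>\<open>W\<close> avoids \<open>S\<close>, so \<open>cls\<close> is injective on
    it and its image fills the whole cycle by cardinality.\<close>
  have "inj_on cls W"
    using WU cls_eq_iff by (auto simp: inj_on_def U_def)
  then have "card (cls ` W) = card (set vs)"
    using cardW c(3) by (simp add: card_image distinct_card)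
  then have eq: "cls ` W = set vs"
    using cls by (intro card_subset_eq) auto
  have "f v \<in> Some ` W" if v: "v \<in> W" for v
  proof -
    obtain z where z: "z \<in> verts G" "f v = Some z" "cls z \<in> cls ` W"
      using cls[OF v] eq by blast
    then obtain v' where "v' \<in> W" "cls z = cls v'" by blast
    then have "z = v'" using cls_eq_iff[of z v'] z(1) WU by (auto simp: U_def)
    then show ?thesis using z(2) \<open>v' \<in> W\<close> by simp
  qed
  moreover have "W \<noteq> {}" using c(1) by (auto simp: W_def)
  ultimately show False
    using acyclic_mapsD[OF f, of W] WU by blast
qed

lemma tree_of_spanning_tree: "f \<in> acyclic_maps G U \<Longrightarrow> tree_of f \<in> spanning_trees K"
  using tree_of_subset connected_tree_of tree_of_no_cycle by (simp add: spanning_trees_def is_tree_def)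

text \<open>On the set \<open>D\<close> of disagreement, acyclicity of \<open>f\<close> gives
  \<open>v \<in> D\<close> mapped to some \<open>z\<close> outside \<open>D\<close>. The second map
  must use the edge between them too, and can do so only as an arc from \<open>z\<close> to
  \<open>v\<close>. Both maps agree at \<open>z\<close>, so \<open>f\<close> swaps \<open>v\<close>
  and \<open>z\<close>, which is a closed set.\<close>

lemma inj_on_tree_of: "inj_on tree_of (acyclic_maps G U)"
proof (rule inj_onI)
  fix f f' assume f: "f \<in> acyclic_maps G U" and f': "f' \<in> acyclic_maps G U" and eq: "tree_of f = tree_of f'"
  define D where "D = {v \<in> U. f v \<noteq> f' v}"
  have "D = {}"
  proof (rule ccontr)
    assume "D \<noteq> {}"
    then obtain v where v: "v \<in> D" "f v \<notin> Some ` D"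
      using acyclic_mapsD[OF f, of D] by (auto simp: D_def)
    have vU: "v \<in> U" "f v \<noteq> f' v" using v(1) by (auto simp: D_def)
    obtain z where z: "f v = Some z" "adjacent G v z" "edge v z \<in> tree_of f"
      by (rule acyclic_maps_D[OF f vU(1)])
    then obtain u where u: "u \<in> U" "edge v z = edge u (the (f' u))"
      unfolding eq by (auto simp: tree_of_def)
    obtain z' where z': "f' u = Some z'" "adjacent G u z'"
      by (rule acyclic_maps_D[OF f' u(1)])
    have "{v, z} = {u, z'}"
      using adjacent_edge(2)[OF z(2)] adjacent_edge(2)[OF z'(2)] u(2) z'(1) by simp
    moreover have "\<not> (v = u \<and> z = z')" using vU(2) z(1) z'(1) by auto
    ultimately have "u = z" "z' = v" by (auto simp: doubleton_eq_iff)
    then have "z \<in> U" "f' z = Some v" using u z' by auto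
    moreover have "z \<notin> D" using v(2) z(1) by auto
    ultimately have "f z = Some v" by (simp add: D_def)
    then have "\<forall>a\<in>{v, z}. f a \<in> Some ` {v, z}" using z(1) by simp
    moreover have "{v, z} \<subseteq> U" "{v, z} \<noteq> {}" using vU(1) \<open>z \<in> U\<close> by auto
    ultimately show False
      using acyclic_mapsD[OF f, of "{v, z}"] by blast
  qed
  then have "f v = f' v" if "v \<in> U" for v using that by (auto simp: D_def)
  then show "f = f'"
    using f f' by (intro PiE_ext[of f U _ f']) (auto simp: acyclic_maps_def)
qed

text \<open>Every vertex outside \<open>S\<close> is mapped one step closer to the root.\<close>

lemma connected_imp_acyclic_map:
  assumes T: "T \<subseteq> edges K" and conn: "connected_graph (K\<lparr>edges := T\<rparr>)"
  obtains f where "f \<in> acyclic_maps G U" "tree_of f \<subseteq> T"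
proof -
  let ?a = "adjacent (K\<lparr>edges := T\<rparr>)"
  obtain s where s: "s \<in> S" "s \<in> verts G" using S_nonempty S_subset by auto
  have rootV: "root \<in> verts K" using cls_root[OF s(1)] s(2) unfolding verts_K by (metis imageI)
  \<comment> \<open>The distance to the root inside \<open>T\<close>, the quantity that the map will
    decrease.\<close>
  define d where "d v = (LEAST n. (?a ^^ n) (cls v) root)" for v
  have d: "(?a ^^ d v) (cls v) root" if "v \<in> verts G" for v
  proof -
    have "?a\<^sup>*\<^sup>* (cls v) root"
      using conn that rootV by (auto simp: connected_graph_def verts_K)
    then have "\<exists>n. (?a ^^ n) (cls v) root" by (simp add: rtranclp_power)
    then show ?thesis unfolding d_def by (rule LeastI_ex)
  qed
  have d_le: "d v \<le> n" if "(?a ^^ n) (cls v) root" for v n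
    unfolding d_def using that by (rule Least_le)
  have "\<exists>z. adjacent G v z \<and> edge v z \<in> T \<and> d z < d v" if v: "v \<in> U" for v
  proof -
    have vV: "v \<in> verts G" "v \<notin> S" using v by (auto simp: U_def)
    have "cls v \<noteq> root" using cls_eq_iff[OF vV(1) s(2)] cls_root[OF s(1)] vV s by auto
    then have "d v \<noteq> 0" using d[OF vV(1)] by (metis relpowp_0_E)
    then obtain m where m: "d v = Suc m" by (cases "d v") auto
    then obtain c where c: "?a (cls v) c" "(?a ^^ m) c root"
      using d[OF vV(1)] by (metis relpowp_Suc_D2)
    then obtain e where e: "e \<in> T" "ends K e = {cls v, c}" by (auto simp: adjacent_def)
    then have eK: "e \<in> edges K" using T by auto
    then have eG: "e \<in> edges G" by (simp add: edges_K)
    then have ends: "ends G e \<subseteq> verts G" "card (ends G e) = 2" using simple by (auto simp: simple_graph_def)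
    \<comment> \<open>As \<open>v\<close> lies outside \<open>S\<close>, its class is a singleton,
      so the edge \<open>e\<close> of \<open>K\<close> really ends at \<open>v\<close> in
      \<open>G\<close>.\<close>
    have "cls v \<in> cls ` ends G e" using e(2) ends_K[OF eK] by auto
    then obtain a where "a \<in> ends G e" "cls a = cls v" by auto
    then have "v \<in> ends G e" using cls_eq_iff[of a v] ends(1) vV by auto
    then obtain z where z: "ends G e = {v, z}"
      using ends(2) by (metis card_2_iff doubleton_eq_iff insertE singletonD)
    then have "c = cls z" using e(2) ends_K[OF eK] by (auto simp: doubleton_eq_iff)
    then have "d z < d v" using d_le c(2) m by (metis le_imp_less_Suc)
    moreover have "adjacent G v z" using eG z by (auto simp: adjacent_def)
    moreover have "edge v z \<in> T" using edgeI[OF eG z] e(1) by simp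
    ultimately show ?thesis by blast
  qed
  then obtain nx where nx: "\<And>v. v \<in> U \<Longrightarrow> adjacent G v (nx v) \<and> edge v (nx v) \<in> T \<and> d (nx v) < d v"
    by metis
  define f where "f = restrict (\<lambda>v. Some (nx v)) U"
  have "acyclic_map U f"
    unfolding acyclic_map_def
  proof (intro allI impI)
    fix W assume W: "W \<subseteq> U" "W \<noteq> {}"
    then obtain v where v: "v \<in> W" "\<And>v'. v' \<in> W \<Longrightarrow> d v \<le> d v'"
      using ex_has_least_nat[of "\<lambda>v. v \<in> W" _ d] by blast
    then have "nx v \<notin> W" using nx[of v] W by force
    then show "\<exists>v\<in>W. f v \<notin> Some ` W" using v W by (intro bexI[of _ v]) (auto simp: f_def)
  qed
  then have "f \<in> acyclic_maps G U"
    using nx by (auto simp: acyclic_maps_def f_def neighbors_def)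
  moreover have "tree_of f \<subseteq> T"
    using nx by (auto simp: tree_of_def f_def)
  ultimately show thesis by (rule that)
qed

text \<open>By connectedness \<open>T\<close> contains the tree of some acyclic map. A further edge
  of \<open>T\<close> would close a cycle with the path joining its ends in that tree.\<close>

lemma spanning_tree_eq_tree_of:
  assumes T: "T \<in> spanning_trees K"
  obtains f where "f \<in> acyclic_maps G U" "T = tree_of f"
proof -
  have T': "T \<subseteq> edges K" "connected_graph (K\<lparr>edges := T\<rparr>)" "\<And>vs es. \<not> is_cycle (K\<lparr>edges := T\<rparr>) vs es"
    using T by (auto simp: spanning_trees_def is_tree_def)
  obtain f where f: "f \<in> acyclic_maps G U" "tree_of f \<subseteq> T"
    using connected_imp_acyclic_map[OF T'(1,2)] .
  have "T \<subseteq> tree_of f"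
  proof (rule subsetI, rule ccontr)
    fix e assume e: "e \<in> T" "e \<notin> tree_of f"
    then have eK: "e \<in> edges K" using T' by auto
    then have eG: "e \<in> edges G" "\<not> ends G e \<subseteq> S" by (auto simp: edges_K)
    then have "ends G e \<subseteq> verts G" "card (ends G e) = 2" using simple by (auto simp: simple_graph_def)
    then obtain a b where ab: "ends G e = {a, b}" "a \<noteq> b" "a \<in> verts G" "b \<in> verts G"
      by (auto simp: card_2_iff)
    have ends: "ends K e = {cls a, cls b}" using ends_K[OF eK] ab by simp
    have neq: "cls a \<noteq> cls b" using cls_eq_iff ab eG by auto
    let ?a = "adjacent (K\<lparr>edges := tree_of f\<rparr>)"
    have "?a\<^sup>*\<^sup>* (cls a) (cls b)"
      using connected_tree_of[OF f(1)] ab by (auto simp: connected_graph_def verts_K)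
    then obtain vs where vs: "vs \<noteq> []" "hd vs = cls a" "last vs = cls b" "distinct vs" "successively ?a vs"
      by (rule rtranclp_obtain_distinct_path)
    obtain m where m: "length vs = Suc m" using vs(1) by (cases vs) auto
    have "\<forall>i\<in>{..<m}. \<exists>e'. e' \<in> tree_of f \<and> ends K e' = {vs ! i, vs ! Suc i}"
      using vs(5) m by (auto simp: successively_conv_nth adjacent_def)
    then obtain c where c: "\<And>i. i < m \<Longrightarrow> c i \<in> tree_of f" "\<And>i. i < m \<Longrightarrow> ends K (c i) = {vs ! i, vs ! Suc i}"
      unfolding bchoice_iff by auto
    \<comment> \<open>The edges of the path followed by \<open>e\<close>, which leads from the last
      vertex back to the first, as the wrapping index demands.\<close>
    define es where "es = map c [0..<m] @ [e]"
    have "inj_on c {..<m}"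
    proof (rule inj_onI)
      fix i j assume ij: "i \<in> {..<m}" "j \<in> {..<m}" "c i = c j"
      then have "{vs ! i, vs ! Suc i} = {vs ! j, vs ! Suc j}" using c(2) by (metis lessThan_iff)
      then show "i = j"
        using ij m vs(4) by (auto simp: doubleton_eq_iff nth_eq_iff_index_eq)
    qed
    then have "distinct es"
      using c(1) e(2) by (auto simp: es_def distinct_map lessThan_atLeast0)
    moreover have "es ! i \<in> T \<and> ends K (es ! i) = {vs ! i, vs ! (Suc i mod length vs)}" if "i < length vs" for i
    proof (cases "i < m")
      case True
      then show ?thesis using c f(2) m by (auto simp: es_def nth_append)
    next
      case False
      then have "i = m" using that m by simp
      then show ?thesis
        using vs(1-3) m e(1) ends by (auto simp: es_def nth_append hd_conv_nth last_conv_nth)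
    qed
    ultimately have "is_cycle (K\<lparr>edges := T\<rparr>) vs es"
      using vs m by (simp add: is_cycle_def es_def)
    then show False using T'(3) by blast
  qed
  then show thesis using that f by blast
qed

lemma num_spanning_trees_eq: "num_spanning_trees K = card (acyclic_maps G (verts G - S))"
proof -
  have "bij_betw tree_of (acyclic_maps G U) (spanning_trees K)"
    unfolding bij_betw_def using inj_on_tree_of tree_of_spanning_tree spanning_tree_eq_tree_of by blast
  then show ?thesis
    unfolding num_spanning_trees_def U_def[symmetric] by (simp add: bij_betw_same_card)
qed

lemma num_spanning_trees_pos:
  assumes "connected_graph K"
  shows "num_spanning_trees K > 0"
proof -
  have "K\<lparr>edges := edges K\<rparr> = K" by simp
  then obtain f where "f \<in> acyclic_maps G U"
    using connected_imp_acyclic_map[of "edges K"] assms by auto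
  moreover have "finite (PiE U (\<lambda>v. Some ` neighbors G v))"
    using finite_verts finite_neighbors[OF simple] by (intro finite_PiE) (auto simp: U_def)
  then have "finite (acyclic_maps G U)"
    by (rule rev_finite_subset) (auto simp: acyclic_maps_def)
  ultimately show ?thesis
    unfolding num_spanning_trees_eq U_def[symmetric] by (auto simp: card_gt_0_iff)
qed

end

section \<open>The contraction and the graph itself as quotients\<close>

lemma num_spanning_trees_contract:
  assumes "simple_graph G" "S \<subseteq> verts G" "S \<noteq> {}"
  shows "num_spanning_trees (contract G S) = card (acyclic_maps G (verts G - S))"
proof -
  interpret rooted_quotient G "contract G S" S "\<lambda>v. if v \<in> S then S else {v}"
    using assms by unfold_locales (auto simp: contract_def)
  show ?thesis by (rule num_spanning_trees_eq)
qed

text \<open>Collapsing one vertex changes nothing, as no edge of a simple graph lies inside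
  \<open>{y}\<close>. Positivity is what permits dividing by the number of spanning trees.\<close>

lemma num_spanning_trees_simple_graph:
  assumes "simple_graph G" "y \<in> verts G"
  shows "num_spanning_trees G = card (acyclic_maps G (verts G - {y}))"
    and "connected_graph G \<Longrightarrow> num_spanning_trees G > 0"
proof -
  have "\<not> ends G e \<subseteq> {y}" if "e \<in> edges G" for e
  proof
    assume "ends G e \<subseteq> {y}"
    then have "card (ends G e) \<le> 1" using card_mono[of "{y}"] by simp
    then show False using assms(1) that by (simp add: simple_graph_def)
  qed
  then interpret rooted_quotient G G "{y}" "\<lambda>v. v"
    using assms by unfold_locales auto
  show "num_spanning_trees G = card (acyclic_maps G (verts G - {y}))"
    by (rule num_spanning_trees_eq)
  show "connected_graph G \<Longrightarrow> num_spanning_trees G > 0"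
    by (rule num_spanning_trees_pos)
qed

section \<open>Hitting times\<close>

text \<open>The law of the walk is a projective limit, so an integrand in the first \<open>n\<close>
  coordinates sees only the composition of the first \<open>n\<close> kernels.\<close>

lemma nn_integral_random_walk_restrict:
  fixes F :: "(nat \<Rightarrow> 'v) \<Rightarrow> ennreal"
  assumes F [measurable]: "F \<in> borel_measurable (PiM {0..<n} (\<lambda>_. count_space UNIV))"
  shows "(\<integral>\<^sup>+\<omega>. F (restrict \<omega> {0..<n}) \<partial>random_walk G x) =
    (\<integral>\<^sup>+\<omega>. F \<omega> \<partial>Ionescu_Tulcea.C (walk_kernel G x) (\<lambda>_. count_space UNIV) 0 n (\<lambda>_. undefined))"
proof -
  interpret IT: Ionescu_Tulcea "walk_kernel G x" "\<lambda>_. count_space UNIV"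
    by (rule Ionescu_Tulcea_walk_kernel)
  have up: "IT.up_to {0..<n} = n"
    unfolding IT.up_to_def by (rule Least_equality) (auto simp: not_le[symmetric])
  have "IT.CI {0..<n} = IT.C 0 n (\<lambda>_. undefined)"
    using IT.distr_C[of n n "\<lambda>_. undefined" 0] by (simp add: IT.CI_def up)
  then have d: "distr IT.PF.lim (PiM {0..<n} (\<lambda>_. count_space UNIV)) (\<lambda>\<omega>. restrict \<omega> {0..<n}) = IT.C 0 n (\<lambda>_. undefined)"
    using IT.distr_lim[of "{0..<n}"] by simp
  have "(\<lambda>\<omega>. restrict \<omega> {0..<n}) \<in> measurable IT.PF.lim (PiM {0..<n} (\<lambda>_. count_space (UNIV::'v set)))"
    by (auto simp: measurable_cong_sets[OF IT.PF.sets_lim refl] intro!: measurable_restrict)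
  from nn_integral_distr[OF this, of F] F show ?thesis
    unfolding random_walk_def by (simp flip: d)
qed

text \<open>Its expectation is that of \<open>f\<close> at time \<open>n\<close> for the walk killed
  on leaving \<open>B\<close>. With \<open>f\<close> constantly one and \<open>B\<close> the
  complement of \<open>y\<close>, it is the probability that \<open>y\<close> is not met at times
  \<open>0\<close> to \<open>n\<close>.\<close>

definition confined :: "'v set \<Rightarrow> ('v \<Rightarrow> ennreal) \<Rightarrow> nat \<Rightarrow> (nat \<Rightarrow> 'v) \<Rightarrow> ennreal" where
  "confined B f n \<omega> = (if \<forall>i\<le>n. \<omega> i \<in> B then f (\<omega> n) else 0)"

lemma measurable_confined:
  assumes "{..n} \<subseteq> I"
  shows "confined B f n \<in> borel_measurable (PiM I (\<lambda>_. count_space UNIV))"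
proof -
  let ?M = "PiM I (\<lambda>_. count_space UNIV)"
  have comp: "(\<lambda>\<omega>. \<omega> i) \<in> measurable ?M (count_space UNIV)" if "i \<le> n" for i
    using assms that by (intro measurable_component_singleton) auto
  have f: "(\<lambda>\<omega>. f (\<omega> n)) \<in> borel_measurable ?M"
    by (rule measurable_compose[OF comp]) simp_all
  have "Measurable.pred ?M (\<lambda>\<omega>. \<omega> i \<in> B)" if "i \<le> n" for i
    by (rule measurable_compose[OF comp[OF that]]) simp
  then have "Measurable.pred ?M (\<lambda>\<omega>. \<forall>i\<in>{..n}. \<omega> i \<in> B)"
    by (intro pred_intros_finite) auto
  then have "{\<omega> \<in> space ?M. \<forall>i\<le>n. \<omega> i \<in> B} \<in> sets ?M"
    unfolding Ball_def atMost_iff pred_def .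
  from measurable_If[OF f measurable_const this] show ?thesis
    unfolding confined_def[abs_def] by simp
qed

lemma sets_random_walk:
  "sets (random_walk G x) = sets (PiM UNIV (\<lambda>_. count_space UNIV))"
proof -
  interpret IT: Ionescu_Tulcea "walk_kernel G x" "\<lambda>_. count_space UNIV"
    by (rule Ionescu_Tulcea_walk_kernel)
  show ?thesis
    unfolding random_walk_def by (rule IT.PF.sets_lim)
qed

lemma measurable_confined_random_walk:
  "confined B f n \<in> borel_measurable (random_walk G x)"
  unfolding measurable_cong_sets[OF sets_random_walk refl] by (rule measurable_confined) simp

lemma nn_integral_confined_0:
  "(\<integral>\<^sup>+\<omega>. confined B f 0 \<omega> \<partial>random_walk G x) = (if x \<in> B then f x else 0)"
proof -
  interpret IT: Ionescu_Tulcea "walk_kernel G x" "\<lambda>_. count_space UNIV"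
    by (rule Ionescu_Tulcea_walk_kernel)
  have [simp]: "(\<lambda>_. undefined) \<in> space (PiM {} (\<lambda>_. count_space (UNIV::'a set)))"
    by (simp add: space_PiM)
  \<comment> \<open>Coordinate \<open>0\<close> is itself drawn, from the point mass at
    \<open>x\<close>; so the position at time \<open>n\<close> involves \<open>n + 1\<close>
    kernels.\<close>
  have "(\<integral>\<^sup>+\<omega>. confined B f 0 \<omega> \<partial>random_walk G x)
      = (\<integral>\<^sup>+\<omega>. confined B f 0 (restrict \<omega> {0..<1}) \<partial>random_walk G x)"
    by (intro nn_integral_cong) (auto simp: confined_def)
  also have "\<dots> = (\<integral>\<^sup>+\<omega>. confined B f 0 \<omega> \<partial>IT.C 0 1 (\<lambda>_. undefined))"
    by (intro nn_integral_random_walk_restrict measurable_confined) auto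
  also have "IT.C 0 1 (\<lambda>_. undefined) = IT.eP 0 (\<lambda>_. undefined)"
    using IT.measurable_eP[of 0] by (simp add: bind_return)
  also have "(\<integral>\<^sup>+\<omega>. confined B f 0 \<omega> \<partial>IT.eP 0 (\<lambda>_. undefined)) = 
     (\<integral>\<^sup>+z. confined B f 0 (fun_upd (\<lambda>_. undefined) 0 z) \<partial>walk_kernel G x 0 (\<lambda>_. undefined))"
    by (intro IT.nn_integral_eP measurable_confined) auto
  also have "\<dots> = (if x \<in> B then f x else 0)"
    by (simp add: walk_kernel_def confined_def nn_integral_return)
  finally show ?thesis .
qed

text \<open>The Markov property at the last step: the kernel for coordinate \<open>Suc n\<close>
  depends on coordinate \<open>n\<close> alone, so integrating the last coordinate out leaves a
  function of the position at time \<open>n\<close>. Survival at the last time turns into the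
  indicator of \<open>B\<close>.\<close>

lemma nn_integral_confined_Suc:
  "(\<integral>\<^sup>+\<omega>. confined B f (Suc n) \<omega> \<partial>random_walk G x) =
    (\<integral>\<^sup>+\<omega>. confined B (\<lambda>v. \<integral>\<^sup>+z. f z * indicator B z \<partial>measure_pmf (pmf_of_set (neighbors G v))) n \<omega>
       \<partial>random_walk G x)"
  (is "_ = (\<integral>\<^sup>+\<omega>. confined B ?h n \<omega> \<partial>_)")
proof -
  interpret IT: Ionescu_Tulcea "walk_kernel G x" "\<lambda>_. count_space UNIV"
    by (rule Ionescu_Tulcea_walk_kernel)
  let ?N = "\<lambda>m. PiM {0..<m} (\<lambda>_. count_space (UNIV :: 'a set))"
  let ?u = "\<lambda>_::nat. undefined :: 'a"
  have u: "?u \<in> space (?N 0)" by (simp add: space_PiM)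
  have if_out: "(\<integral>\<^sup>+z. (if c then g z else 0) \<partial>M) = (if c then integral\<^sup>N M g else 0)"
    for c and g :: "'a \<Rightarrow> ennreal" and M by (cases c) simp_all
  have m: "confined B f (Suc n) \<in> borel_measurable (?N (Suc (Suc n)))"
    by (rule measurable_confined) auto
  have "(\<integral>\<^sup>+\<omega>. confined B f (Suc n) \<omega> \<partial>random_walk G x)
      = (\<integral>\<^sup>+\<omega>. confined B f (Suc n) (restrict \<omega> {0..<Suc (Suc n)}) \<partial>random_walk G x)"
    by (intro nn_integral_cong) (auto simp: confined_def)
  also have "\<dots> = (\<integral>\<^sup>+\<omega>. confined B f (Suc n) \<omega> \<partial>IT.C 0 (Suc (Suc n)) ?u)"
    by (intro nn_integral_random_walk_restrict m)
  also have "\<dots> = (\<integral>\<^sup>+\<omega>. (\<integral>\<^sup>+\<omega>'. confined B f (Suc n) \<omega>' \<partial>IT.eP (Suc n) \<omega>) \<partial>IT.C 0 (Suc n) ?u)"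
    using IT.measurable_eP[of "Suc n"] IT.sets_C[OF u, of "Suc n"]
    unfolding IT.C.simps(2)[of 0 "Suc n"] add_0
    by (intro nn_integral_bind[where B="?N (Suc (Suc n))"] m)
       (simp add: measurable_cong_sets[OF IT.sets_C[OF u, of "Suc n"] refl] del: IT.C.simps)
  also have "\<dots> = (\<integral>\<^sup>+\<omega>. confined B ?h n \<omega> \<partial>IT.C 0 (Suc n) ?u)"
  proof (intro nn_integral_cong)
    fix \<omega> assume "\<omega> \<in> space (IT.C 0 (Suc n) ?u)"
    then have w: "\<omega> \<in> space (?N (Suc n))"
      using IT.space_C[OF u, of "Suc n"] by simp
    have "(\<integral>\<^sup>+\<omega>'. confined B f (Suc n) \<omega>' \<partial>IT.eP (Suc n) \<omega>) =
       (\<integral>\<^sup>+z. confined B f (Suc n) (fun_upd \<omega> (Suc n) z) \<partial>walk_kernel G x (Suc n) \<omega>)"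
      by (rule IT.nn_integral_eP[OF w m])
    also have "\<dots> = (\<integral>\<^sup>+z. (if \<forall>i\<le>n. \<omega> i \<in> B then f z * indicator B z else 0) \<partial>walk_kernel G x (Suc n) \<omega>)"
      by (intro nn_integral_cong) (auto simp: confined_def le_Suc_eq)
    also have "\<dots> = (if \<forall>i\<le>n. \<omega> i \<in> B then \<integral>\<^sup>+z. f z * indicator B z \<partial>walk_kernel G x (Suc n) \<omega> else 0)"
      by (rule if_out)
    also have "\<dots> = confined B ?h n \<omega>"
      by (auto simp: confined_def walk_kernel_def)
    finally show "(\<integral>\<^sup>+\<omega>'. confined B f (Suc n) \<omega>' \<partial>IT.eP (Suc n) \<omega>) = confined B ?h n \<omega>" .
  qed
  also have "\<dots> = (\<integral>\<^sup>+\<omega>. confined B ?h n (restrict \<omega> {0..<Suc n}) \<partial>random_walk G x)"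
    by (intro nn_integral_random_walk_restrict[symmetric] measurable_confined) auto
  also have "\<dots> = (\<integral>\<^sup>+\<omega>. confined B ?h n \<omega> \<partial>random_walk G x)"
    by (intro nn_integral_cong) (auto simp: confined_def)
  finally show ?thesis .
qed

text \<open>Started in \<open>V\<close> the walk stays in \<open>V\<close>, because each step is
  supported on the neighbours. This trades the complement of \<open>y\<close> for the finite set of
  vertices other than \<open>y\<close>.\<close>

lemma nn_integral_confined_subset_verts:
  assumes "\<And>v. v \<in> V \<Longrightarrow> neighbors G v \<subseteq> V \<and> neighbors G v \<noteq> {}" and "finite V" and "x \<in> V"
  shows "(\<integral>\<^sup>+\<omega>. confined A f n \<omega> \<partial>random_walk G x) = (\<integral>\<^sup>+\<omega>. confined (V \<inter> A) f n \<omega> \<partial>random_walk G x)"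
proof (induction n arbitrary: f)
  case 0
  then show ?case using assms(3) by (simp only: nn_integral_confined_0) auto
next
  case (Suc n)
  have eq: "(\<integral>\<^sup>+z. f z * indicator A z \<partial>measure_pmf (pmf_of_set (neighbors G v))) =
      (\<integral>\<^sup>+z. f z * indicator (V \<inter> A) z \<partial>measure_pmf (pmf_of_set (neighbors G v)))" if "v \<in> V" for v
    using assms(1)[OF that] finite_subset[OF _ \<open>finite V\<close>, of "neighbors G v"]
    by (intro nn_integral_cong_AE)
       (auto simp: AE_measure_pmf_iff set_pmf_of_set split: split_indicator)
  show ?case
    unfolding nn_integral_confined_Suc[where B=A] nn_integral_confined_Suc[where B="V \<inter> A"] Suc.IH
    by (intro nn_integral_cong) (auto simp: confined_def eq)
qed

section \<open>Hitting times as sums of survival probabilities\<close>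

lemma less_steps_to_iff: "enat n < steps_to y \<omega> \<longleftrightarrow> (\<forall>i\<le>n. \<omega> i \<noteq> y)"
proof (cases "\<exists>i. \<omega> i = y")
  case True
  define m where "m = (LEAST i. \<omega> i = y)"
  have m: "\<omega> m = y"
    unfolding m_def using True by (rule LeastI_ex)
  have le: "m \<le> i" if "\<omega> i = y" for i
    unfolding m_def using that by (rule Least_le)
  have "steps_to y \<omega> = enat m"
    unfolding steps_to_def using m le by (intro antisym INF_lower INF_greatest) auto
  then show ?thesis
    using m le by (metis enat_ord_simps(2) leD leI order_trans)
next
  case False
  then show ?thesis by (simp add: steps_to_def top_enat_def)
qed

text \<open>The tail-sum formula for the expectation of an extended natural number.\<close>

lemma hitting_time_eq_suminf:
  "hitting_time G x y = (\<Sum>n. \<integral>\<^sup>+\<omega>. confined (- {y}) (\<lambda>_. 1) n \<omega> \<partial>random_walk G x)"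
proof -
  have comp: "(\<lambda>\<omega>. \<omega> i) \<in> measurable (random_walk G x) (count_space UNIV)" for i
    unfolding measurable_cong_sets[OF sets_random_walk refl]
    by (rule measurable_component_singleton) simp
  have ev: "{\<omega> \<in> space (random_walk G x). \<forall>i\<le>n. \<omega> i \<noteq> y} \<in> sets (random_walk G x)" for n
  proof -
    have "Measurable.pred (random_walk G x) (\<lambda>\<omega>. \<omega> i \<noteq> y)" for i
      using comp[of i] by (rule measurable_compose) simp
    then have "Measurable.pred (random_walk G x) (\<lambda>\<omega>. \<forall>i\<in>{..n}. \<omega> i \<noteq> y)"
      by (intro pred_intros_finite) auto
    then show ?thesis unfolding Ball_def atMost_iff pred_def .
  qed
  have meas: "steps_to y \<in> measurable (random_walk G x) (count_space UNIV)"
  proof -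
    \<comment> \<open>An infimum over a set depending on the trajectory is rewritten over all times,
      with default \<infinity>, so that it is a countable infimum of measurable functions.\<close>
    have "steps_to y = (\<lambda>\<omega>. INF n\<in>UNIV. if \<omega> n = y then enat n else \<infinity>)"
    proof
      fix \<omega>
      show "steps_to y \<omega> = (INF n\<in>UNIV. if \<omega> n = y then enat n else \<infinity>)"
        unfolding steps_to_def
      proof (intro antisym INF_greatest)
        fix n show "(INF n\<in>{n. \<omega> n = y}. enat n) \<le> (if \<omega> n = y then enat n else \<infinity>)"
          by (auto intro: INF_lower)
      next
        fix n assume "n \<in> {n. \<omega> n = y}"
        then show "(INF n\<in>UNIV. if \<omega> n = y then enat n else \<infinity>) \<le> enat n"
          by (intro INF_lower2[of n]) auto
      qed
    qed
    also have "\<dots> \<in> measurable (random_walk G x) (count_space UNIV)"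
      by (intro measurable_INF) (auto intro: measurable_compose[OF comp])
    finally show ?thesis .
  qed
  show ?thesis
    unfolding hitting_time_def nn_integral_enat_function[OF meas]
  proof (intro suminf_cong)
    fix n
    have "emeasure (random_walk G x) {\<omega> \<in> space (random_walk G x). enat n < steps_to y \<omega>} =
      (\<integral>\<^sup>+\<omega>. indicator {\<omega> \<in> space (random_walk G x). \<forall>i\<le>n. \<omega> i \<noteq> y} \<omega> \<partial>random_walk G x)"
      unfolding less_steps_to_iff by (rule nn_integral_indicator[OF ev, symmetric])
    also have "\<dots> = (\<integral>\<^sup>+\<omega>. confined (- {y}) (\<lambda>_. 1) n \<omega> \<partial>random_walk G x)"
      by (intro nn_integral_cong) (auto simp: confined_def indicator_def)
    finally show "emeasure (random_walk G x) {\<omega> \<in> space (random_walk G x). enat n < steps_to y \<omega>} =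
       (\<integral>\<^sup>+\<omega>. confined (- {y}) (\<lambda>_. 1) n \<omega> \<partial>random_walk G x)" .
  qed
qed

text \<open>Partial sums are \<open>e 0 - e n\<close>. They are bounded, so \<open>p\<close> is
  summable and tends to zero, and the bound by \<open>K\<close> forces the remainder
  \<open>e n\<close> to zero as well. In the application \<open>p n\<close> is a survival
  probability and \<open>e n\<close> the expectation of a bounded function on survival.\<close>

lemma suminf_ennreal_telescoping:
  fixes p e :: "nat \<Rightarrow> ennreal" and K :: real
  assumes step: "\<And>n. e n = p n + e (Suc n)" and fin: "e 0 < \<infinity>" and bound: "\<And>n. e n \<le> ennreal K * p n"
  shows "(\<Sum>n. p n) = e 0"
proof -
  have le: "p n \<le> e n" "e (Suc n) \<le> e n" for n
    using step[of n] by simp_all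
  have fe: "e n < \<infinity>" for n
    by (induction n) (use fin le(2) in \<open>auto intro: le_less_trans\<close>)
  then have fp: "p n < \<infinity>" for n
    using le(1) by (rule le_less_trans[rotated])
  define E q where "E n = enn2real (e n)" and "q n = enn2real (p n)" for n
  have e: "e n = ennreal (E n)" and p: "p n = ennreal (q n)" for n
    using fe fp by (simp_all add: E_def q_def less_top)
  have nn: "0 \<le> E n" "0 \<le> q n" for n by (simp_all add: E_def q_def)
  have E: "E n = q n + E (Suc n)" for n
    using step[of n] nn by (simp add: e p ennreal_plus[symmetric] del: ennreal_plus)
  \<comment> \<open>\<open>ennreal\<close> truncates negative numbers to zero; the absolute value
    gives a constant that is valid over the reals.\<close>
  have b: "E n \<le> \<bar>K\<bar> * q n" for n
  proof -
    have "ennreal (E n) \<le> ennreal \<bar>K\<bar> * p n"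
      using bound[of n] e by (metis abs_ge_self dual_order.trans ennreal_leI mult_right_mono zero_le)
    then show ?thesis
      using nn by (simp add: p ennreal_mult[symmetric])
  qed
  have tele: "(\<Sum>i<n. q i) = E 0 - E n" for n
  proof (induction n)
    case (Suc n)
    then show ?case using E[of n] by simp
  qed simp
  have "summable q"
    using nn by (intro summableI_nonneg_bounded[where x="E 0"]) (simp_all add: tele)
  then have "q \<longlonglongrightarrow> 0" by (rule summable_LIMSEQ_zero)
  then have "(\<lambda>n. \<bar>K\<bar> * q n) \<longlonglongrightarrow> 0" by (rule tendsto_mult_right_zero)
  then have "E \<longlonglongrightarrow> 0"
    using nn b by (intro tendsto_sandwich[of "\<lambda>_. 0" E _ "\<lambda>n. \<bar>K\<bar> * q n"]) auto
  then have "(\<lambda>n. E 0 - E n) \<longlonglongrightarrow> E 0 - 0" by (intro tendsto_diff tendsto_const)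
  then have "q sums E 0" by (simp add: sums_def tele)
  then show ?thesis
    unfolding e p using nn by (simp add: suminf_ennreal2 sums_iff)
qed

text \<open>By the one-step equation, the expectation of \<open>k\<close> along the walk killed at
  \<open>y\<close> drops in each step by the probability of having survived so far. Summing the
  drops gives \<open>k x\<close> on one side and the tail sum of the hitting time on the
  other.\<close>

lemma hitting_time_eqI:
  fixes k :: "'v \<Rightarrow> real"
  assumes "simple_graph G" and ne: "\<And>v. v \<in> verts G \<Longrightarrow> neighbors G v \<subseteq> verts G \<and> neighbors G v \<noteq> {}"
    and x: "x \<in> verts G"
    and k_nonneg: "\<And>v. 0 \<le> k v" and "k y = 0"
    and k_eq: "\<And>v. v \<in> verts G \<Longrightarrow> v \<noteq> y \<Longrightarrow>
      real (vertex_degree G v) * k v = real (vertex_degree G v) + (\<Sum>z\<in>neighbors G v. k z)"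
  shows "hitting_time G x y = ennreal (k x)"
proof -
  define B where "B = verts G \<inter> - {y}"
  have finV: "finite (verts G)" using \<open>simple_graph G\<close> by (simp add: simple_graph_def)
  define I where "I f n = (\<integral>\<^sup>+\<omega>. confined B f n \<omega> \<partial>random_walk G x)" for f n
  have step: "I (\<lambda>v. ennreal (k v)) n = I (\<lambda>_. 1) n + I (\<lambda>v. ennreal (k v)) (Suc n)" for n
  proof -
    let ?h = "\<lambda>v. \<integral>\<^sup>+z. ennreal (k z) * indicator B z \<partial>measure_pmf (pmf_of_set (neighbors G v))"
    \<comment> \<open>The one-step equation divided by the degree; restricting the average to
      \<open>B\<close> loses only \<open>y\<close>, where \<open>k\<close> vanishes.\<close>
    have h: "ennreal (k v) = 1 + ?h v" if "v \<in> B" for v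
    proof -
      have v: "v \<in> verts G" "v \<noteq> y" using that by (auto simp: B_def)
      have nb: "finite (neighbors G v)" "neighbors G v \<noteq> {}" "neighbors G v \<subseteq> verts G"
        using ne[OF v(1)] finV finite_subset by auto
      have d: "0 < real (vertex_degree G v)"
        using nb by (simp add: vertex_degree_def card_gt_0_iff)
      have "?h v = (\<integral>\<^sup>+z. ennreal (k z) \<partial>measure_pmf (pmf_of_set (neighbors G v)))"
        using nb \<open>k y = 0\<close> by (intro nn_integral_cong_AE)
          (auto simp: AE_measure_pmf_iff set_pmf_of_set B_def split: split_indicator)
      also have "\<dots> = ennreal ((\<Sum>z\<in>neighbors G v. k z) / vertex_degree G v)"
        using nb d k_nonneg by (subst nn_integral_pmf_of_set)
          (auto simp: vertex_degree_def ennreal_of_nat_eq_real_of_nat divide_ennreal sum_nonneg)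
      also have "1 + \<dots> = ennreal (1 + (\<Sum>z\<in>neighbors G v. k z) / vertex_degree G v)"
        using k_nonneg by (subst ennreal_plus) (auto simp: sum_nonneg)
      also have "1 + (\<Sum>z\<in>neighbors G v. k z) / vertex_degree G v = k v"
        using k_eq[OF v] d by (simp add: field_simps)
      finally show ?thesis by simp
    qed
    have "I (\<lambda>v. ennreal (k v)) n = (\<integral>\<^sup>+\<omega>. confined B (\<lambda>_. 1) n \<omega> + confined B ?h n \<omega> \<partial>random_walk G x)"
      unfolding I_def by (intro nn_integral_cong) (auto simp: confined_def h)
    also have "\<dots> = I (\<lambda>_. 1) n + (\<integral>\<^sup>+\<omega>. confined B ?h n \<omega> \<partial>random_walk G x)"
      unfolding I_def by (intro nn_integral_add measurable_confined_random_walk)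
    also have "(\<integral>\<^sup>+\<omega>. confined B ?h n \<omega> \<partial>random_walk G x) = I (\<lambda>v. ennreal (k v)) (Suc n)"
      unfolding I_def nn_integral_confined_Suc ..
    finally show ?thesis .
  qed
  \<comment> \<open>By nonnegativity, the sum of \<open>k\<close> over all vertices bounds each of
    its values there.\<close>
  have bound: "I (\<lambda>v. ennreal (k v)) n \<le> ennreal (\<Sum>v\<in>verts G. k v) * I (\<lambda>_. 1) n" for n
  proof -
    have "I (\<lambda>v. ennreal (k v)) n
        \<le> (\<integral>\<^sup>+\<omega>. ennreal (\<Sum>v\<in>verts G. k v) * confined B (\<lambda>_. 1) n \<omega> \<partial>random_walk G x)"
      unfolding I_def
      by (intro nn_integral_mono) (auto simp: confined_def B_def finV k_nonneg intro!: ennreal_leI member_le_sum)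
    also have "\<dots> = ennreal (\<Sum>v\<in>verts G. k v) * I (\<lambda>_. 1) n"
      unfolding I_def by (intro nn_integral_cmult measurable_confined_random_walk)
    finally show ?thesis .
  qed
  have I0: "I (\<lambda>v. ennreal (k v)) 0 = ennreal (k x)"
    unfolding I_def nn_integral_confined_0 using x \<open>k y = 0\<close> by (auto simp: B_def)
  have "hitting_time G x y = (\<Sum>n. I (\<lambda>_. 1) n)"
    unfolding hitting_time_eq_suminf I_def B_def
    by (intro suminf_cong nn_integral_confined_subset_verts ne finV x)
  also have "\<dots> = ennreal (k x)"
    using suminf_ennreal_telescoping[of "I (\<lambda>v. ennreal (k v))" "I (\<lambda>_. 1)", OF step _ bound]
    by (simp add: I0)
  finally show ?thesis .
qed

text \<open>The case of equal end points stands apart because the graph may then be a single vertex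
  without neighbours. Avoiding \<open>y\<close> up to time \<open>n\<close> entails avoiding it at
  time \<open>0\<close>, which has probability zero.\<close>

lemma hitting_time_refl: "hitting_time G y y = 0"
proof -
  have "(\<integral>\<^sup>+\<omega>. confined (- {y}) (\<lambda>_. 1) n \<omega> \<partial>random_walk G y) \<le>
     (\<integral>\<^sup>+\<omega>. confined (- {y}) (\<lambda>_. 1) 0 \<omega> \<partial>random_walk G y)" for n
    by (intro nn_integral_mono) (auto simp: confined_def)
  then show ?thesis
    by (simp add: hitting_time_eq_suminf nn_integral_confined_0 del: nn_integral_const)
qed

section \<open>The path formula for hitting times\<close>

theorem theorem2p7:
  fixes G :: "('v, 'e) multigraph" and x y :: 'v
  assumes "simple_graph G" and "connected_graph G"
    and "x \<in> verts G" and "y \<in> verts G"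
  shows "hitting_time G x y =
           ennreal (1 / real (num_spanning_trees G) *
             (\<Sum>u\<in>verts G. real (vertex_degree G u) *
               (\<Sum>P\<in>{P \<in> simple_paths G x u. y \<notin> set P}.
                 R_invariant (delete_verts G (set P \<union> {y})) (\<lambda>v. real (vertex_degree G v)))))
         \<and> (\<forall>u\<in>verts G. \<forall>P\<in>simple_paths G x u. y \<notin> set P \<longrightarrow>
              R_invariant (delete_verts G (set P \<union> {y})) (\<lambda>v. real (vertex_degree G v))
                = real (num_spanning_trees (contract G (set P \<union> {y}))))"
proof -
  define H where "H = delete_verts G {y}"
  define w where "w = (\<lambda>v. real (vertex_degree G v))"
  define \<tau> where "\<tau> = real (num_spanning_trees G)"
  \<comment> \<open>Paths in \<open>H\<close> are the paths avoiding \<open>y\<close>, which builds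
    in the killing; the weights remain the degrees in \<open>G\<close>.\<close>
  define green where "green v u = (\<Sum>P\<in>simple_paths H v u. R_invariant (delete_verts H (set P)) w)" for v u
  define k where "k v = 1 / \<tau> * (\<Sum>u\<in>verts G. w u * green v u)" for v
  have H: "simple_graph H" unfolding H_def by (rule simple_graph_delete_verts) fact
  \<comment> \<open>The invariant of \<open>H\<close> counts the acyclic maps off \<open>y\<close>,
    that is, the spanning trees of \<open>G\<close> oriented towards \<open>y\<close>.\<close>
  have \<tau>: "\<tau> > 0" "R_invariant H w = \<tau>"
    using num_spanning_trees_simple_graph[OF assms(1,4)] assms(2)
      R_invariant_delete_verts_degree[OF assms(1), of "{y}"]
    by (simp_all add: \<tau>_def H_def w_def)
  have R_nonneg: "R_invariant (delete_verts H S) w \<ge> 0" for S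
    using R_invariant_delete_verts_degree[OF assms(1), of "insert y S"] by (simp add: H_def w_def)
  have green: "w v * green v u = (if v = u then \<tau> else 0) + (\<Sum>z\<in>neighbors H v. green z u)"
    if "v \<in> verts G" "v \<noteq> y" for u v
    using R_invariant_Green_function[OF H, of v w u] that \<tau>(2) by (simp add: green_def H_def)
  have "simple_paths H y u = {}" for u
    using hd_in_set by (fastforce simp: H_def simple_paths_def)
  then have green_y: "green y u = 0" for u
    by (simp add: green_def)
  have "hitting_time G x y = ennreal (k x)"
  proof (cases "x = y")
    case True
    then show ?thesis by (simp add: hitting_time_refl k_def green_y)
  next
    case False
    show ?thesis
    proof (rule hitting_time_eqI)
      fix v assume v: "v \<in> verts G"
      \<comment> \<open>Since \<open>x\<close> and \<open>y\<close> differ, there is another vertex,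
        and the first edge on the way to it supplies a neighbour.\<close>
      obtain v' where "v' \<in> verts G" "v' \<noteq> v" using False assms by metis
      then have "(adjacent G)\<^sup>*\<^sup>* v v'" "v \<noteq> v'" using assms(2) v by (auto simp: connected_graph_def)
      then obtain z where "adjacent G v z" by (metis converse_rtranclpE)
      then show "neighbors G v \<subseteq> verts G \<and> neighbors G v \<noteq> {}"
        using neighbors_subset[OF assms(1)] by (auto simp: neighbors_def)
    next
      fix v
      show "0 \<le> k v"
        unfolding k_def green_def using \<tau>(1) R_nonneg
        by (intro mult_nonneg_nonneg sum_nonneg) (auto simp: w_def)
    next
      show "k y = 0" by (simp add: k_def green_y)
    next
      fix v assume v: "v \<in> verts G" "v \<noteq> y"
      \<comment> \<open>The only neighbour of \<open>v\<close> that \<open>H\<close> may lack is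
        \<open>y\<close>, and it contributes zero.\<close>
      have "(\<Sum>z\<in>neighbors H v. k z) = (\<Sum>z\<in>neighbors G v. k z)"
        using v finite_neighbors[OF assms(1)]
        by (intro sum.mono_neutral_left) (auto simp: neighbors_def H_def k_def green_y)
      moreover have "(\<Sum>z\<in>neighbors H v. k z) = 1 / \<tau> * (\<Sum>u\<in>verts G. w u * (\<Sum>z\<in>neighbors H v. green z u))"
        unfolding k_def sum_distrib_left by (rule sum.swap)
      moreover have "w v * k v = 1 / \<tau> * (\<Sum>u\<in>verts G. w u * (w v * green v u))"
        by (simp add: k_def sum_distrib_left mult_ac)
      \<comment> \<open>The diagonal term of the Green function survives only at
        \<open>u = v\<close>; divided by \<open>\<tau>\<close> it becomes the summand
        \<open>w v\<close> of the one-step equation.\<close>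
      moreover have "(\<Sum>u\<in>verts G. w u * (if v = u then \<tau> else 0)) = w v * \<tau>"
        using v assms(1) by (simp add: if_distrib[of "(*) _"] simple_graph_def cong: if_cong)
      ultimately have "w v * k v = w v + (\<Sum>z\<in>neighbors G v. k z)"
        using \<tau>(1) by (simp add: green[OF v] distrib_left sum.distrib)
      then show "real (vertex_degree G v) * k v = real (vertex_degree G v) + (\<Sum>z\<in>neighbors G v. k z)"
        by (simp add: w_def)
    qed (use assms in auto)
  qed
  also have "k x = 1 / real (num_spanning_trees G) *
             (\<Sum>u\<in>verts G. real (vertex_degree G u) *
               (\<Sum>P\<in>{P \<in> simple_paths G x u. y \<notin> set P}.
                 R_invariant (delete_verts G (set P \<union> {y})) (\<lambda>v. real (vertex_degree G v))))"
    unfolding k_def green_def \<tau>_def w_def H_def by (simp add: simple_paths_delete_verts)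
  finally have "hitting_time G x y = ennreal \<dots>" .
  moreover have "R_invariant (delete_verts G (set P \<union> {y})) (\<lambda>v. real (vertex_degree G v))
      = real (num_spanning_trees (contract G (set P \<union> {y})))"
    if "P \<in> simple_paths G x u" for P u
  proof -
    have "set P \<union> {y} \<subseteq> verts G" using that assms(4) by (auto simp: simple_paths_def)
    then show ?thesis
      using R_invariant_delete_verts_degree[OF assms(1)] num_spanning_trees_contract[OF assms(1)] by simp
  qed
  ultimately show ?thesis by blast
qed

end
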